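(* Let $\mathfrak{g}\neq0$ be a (finite-dimensional) semi-simple Lie algebra and let $M$ be a non-empty (oriented and time-oriented) globally hyperbolic Lorentzian manifold of dimension $m\ge2$ with a compact spacelike Cauchy surface. Let $(\mathfrak{F}_{\mathrm{YM}},\ell)$ be the field theory $L_\infty[1]$-algebra of non-Abelian Yang-Mills theory on $M$ (treated perturbatively around the trivial background solution). Then there does not exist a Møller map $(\widehat{\mathrm{Sym}}\,\mathfrak{F}_{\mathrm{YM}}'[[\lambda]],\delta_0)\to(\widehat{\mathrm{Sym}}\,\mathfrak{F}_{\mathrm{YM}}'[[\lambda]],\delta_0+\delta)$.
   Context: Let $\mathbb{K}\in\{\mathbb{R},\mathbb{C}\}$. Complexes are cochain complexes (differential of degree $+1$), with Koszul signs throughout. Yang-Mills theory: $\Omega^\bullet(M,\mathfrak{g})=\Omega^\bullet(M)\otimes\mathfrak{g}$ are $\mathfrak{g}$-valued smooth differential forms, with $[\alpha_1\otimes t_1,\alpha_2\otimes t_2]=\alpha_1\wedge\alpha_2\otimes[t_1,t_2]$, and $\ast$ is the Hodge operator. The complex is $$\mathfrak{F}_{\mathrm{YM}}=\big(\Omega^0(M,\mathfrak{g})\xrightarrow{\mathrm{d}_{\mathrm{dR}}}\Omega^1(M,\mathfrak{g})\xrightarrow{\mathrm{d}_{\mathrm{dR}}\ast\mathrm{d}_{\mathrm{dR}}}\Omega^{m-1}(M,\mathfrak{g})\xrightarrow{\mathrm{d}_{\mathrm{dR}}}\Omega^m(M,\mathfrak{g})\big)$$ in degrees $\{-1,0,1,2\}$,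 with elements denoted $c,A,A^\ddagger,c^\ddagger$ respectively. The brackets are $\ell_1=\mathrm{d}$ (the differential of $\mathfrak{F}_{\mathrm{YM}}$) and, up to graded symmetry, $\ell_2(c_1,c_2)=-[c_1,c_2]$, $\ell_2(A,c)=[A,c]$, $\ell_2(A^\ddagger,c)=-[A^\ddagger,c]$, $\ell_2(c^\ddagger,c)=[c^\ddagger,c]$, $\ell_2(A,A^\ddagger)=[A,A^\ddagger]$, $\ell_2(A_1,A_2)=\mathrm{d}_{\mathrm{dR}}\ast[A_1,A_2]+[A_1,\ast\mathrm{d}_{\mathrm{dR}}A_2]+[A_2,\ast\mathrm{d}_{\mathrm{dR}}A_1]$, $\ell_3(A_1,A_2,A_3)=[A_1,\ast[A_2,A_3]]+[A_2,\ast[A_3,A_1]]+[A_3,\ast[A_1,A_2]]$; all other components and all $\ell_n$ with $n\ge4$ vanish. (The Maurer-Cartan equation $\sum_n\frac{1}{n!}\ell_n(A,\dots,A)=0$ is the Yang-Mills equation $\mathrm{d}_A\ast F_A=0$, with $\mathrm{d}_A=\mathrm{d}_{\mathrm{dR}}+[A,\,\cdot\,]$ and $F_A=\mathrm{d}_{\mathrm{dR}}A+\frac12[A,A]$.) A field theory $L_\infty[1]$-algebra $(\mathfrak{F},\ell)$ consists of a bounded cochain complex $(\mathfrak{F},\mathrm{d})$ whose components are the nuclear Fréchet spaces of smooth sections of vector bundles over a manifold, whose differential consists of linear differential operators, together with degree $1$ continuous linear maps $\ell_n:\mathrm{Sym}^n\mathfrak{F}\to\mathfrak{F}$, $n\ge1$,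 with $\ell_1=\mathrm{d}$, satisfying the homotopy Jacobi identities $\sum_{i+j=n+1}\ell_i(\ell_j\otimes\mathrm{id}^{\otimes(i-1)})\sum_{\sigma\in\mathrm{Sh}(j,i-1)}\gamma_\sigma=0$ for all $n\geq 1$ ($\mathrm{Sh}$ shuffles, $\gamma_\sigma$ permutation action with Koszul signs). For a complex $V$ of complete DF-spaces, $\widehat{\mathrm{Sym}}\,V=\bigoplus_{n\ge0}(V^{\widehat\otimes n})_{\Sigma_n}$ is the completed symmetric algebra, with $\widehat\otimes$ the completed projective tensor product. $\mathfrak{F}'$ is the complex of strong duals, $(\mathfrak{F}')^i=(\mathfrak{F}^{-i})'$. Transposition gives degree $1$ continuous linear maps $\ell_n':\mathfrak{F}'\to(\widehat{\mathrm{Sym}}^n\mathfrak{F})'\cong\widehat{\mathrm{Sym}}^n\mathfrak{F}'$, $\ell_n'(\varphi)=-(-1)^{|\varphi|}\varphi\circ\ell_n$, where $\varphi_1\cdots\varphi_n$ is identified with the functional $\sum_{\sigma\in\Sigma_n}(\varphi_1\otimes\cdots\otimes\varphi_n)\circ\gamma_\sigma$. The Chevalley-Eilenberg differential $\delta_0+\delta$ on $\widehat{\mathrm{Sym}}\,\mathfrak{F}'[[\lambda]]$ ($\lambda$ a formal parameter of degree $0$) is given on generators $\mathfrak{F}'$ by $\delta_0=\ell_1'$ and $\delta=\sum_{n\ge2}\lambda^{n-1}\ell_n'$, both extended as continuous $\mathbb{K}[[\lambda]]$-linear degree $1$ derivations; it squares to zero. A Møller map is a cochain map $K=\sum_{n\ge0}\lambda^nK_n:(\widehat{\mathrm{Sym}}\,\mathfrak{F}'[[\lambda]],\delta_0)\to(\widehat{\mathrm{Sym}}\,\mathfrak{F}'[[\lambda]],\delta_0+\delta)$,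 with $K_n$ degree $0$ linear endomorphisms of $\widehat{\mathrm{Sym}}\,\mathfrak{F}'$ and $K_0=\mathrm{id}$. *)

theory Defs
  imports
    "HOL-Analysis.Analysis"
    "HOL-Combinatorics.Permutations"
    "HOL-Library.Function_Algebras"
begin

section \<open>Smooth maps on open subsets of Euclidean spaces\<close>

text \<open>Both notions are only used on open sets.\<close>

fun C_times :: "nat \<Rightarrow> 'e::euclidean_space set \<Rightarrow> ('e \<Rightarrow> 'f::real_normed_vector) \<Rightarrow> bool" where
  "C_times 0 S f \<longleftrightarrow> continuous_on S f"
| "C_times (Suc k) S f \<longleftrightarrow>
     (\<forall>x\<in>S. f differentiable (at x)) \<and>
     (\<forall>v. C_times k S (\<lambda>x. frechet_derivative f (at x) v))"

definition smooth_on :: "'e::euclidean_space set \<Rightarrow> ('e \<Rightarrow> 'f::real_normed_vector) \<Rightarrow> bool" where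
  "smooth_on S f \<longleftrightarrow> (\<forall>k. C_times k S f)"

fun iter_deriv :: "'e::euclidean_space list \<Rightarrow> ('e \<Rightarrow> 'f::real_normed_vector) \<Rightarrow> 'e \<Rightarrow> 'f" where
  "iter_deriv [] f = f"
| "iter_deriv (w # ws) f = (\<lambda>x. frechet_derivative (iter_deriv ws f) (at x) w)"


section \<open>Oriented and time-oriented Lorentzian manifolds\<close>

text \<open>
  The underlying Hausdorff second countable space is a type. A manifold of dimension
  \<open>CARD('m)\<close> is given by an atlas of charts with values in \<open>real ^ 'm\<close>; the linear order on \<open>'m\<close>
  fixes the standard orientation of \<open>real ^ 'm\<close>. A chart is an open set together with its
  coordinate map. Tensor fields on the manifold are families of local representatives, one for
  each chart of the atlas, which match under all coordinate changes.
\<close>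

type_synonym ('a, 'm) chart = "'a set \<times> ('a \<Rightarrow> real ^ 'm)"

record ('a, 'm) spacetime =
  atlas :: "('a, 'm) chart set"
  metric :: "('a, 'm) chart \<Rightarrow> real ^ 'm \<Rightarrow> real ^ 'm ^ 'm"
  tfield :: "('a, 'm) chart \<Rightarrow> real ^ 'm \<Rightarrow> real ^ 'm"

definition cdom :: "('a, 'm) chart \<Rightarrow> 'a set" where
  "cdom c = fst c"

definition coord :: "('a, 'm) chart \<Rightarrow> 'a \<Rightarrow> real ^ 'm" where
  "coord c = snd c"

definition cimg :: "('a, 'm) chart \<Rightarrow> (real ^ 'm) set" where
  "cimg c = coord c ` cdom c"

definition param :: "('a, 'm) chart \<Rightarrow> real ^ 'm \<Rightarrow> 'a" where
  "param c = inv_into (cdom c) (coord c)"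

definition is_chart :: "('a::topological_space, 'm::finite) chart \<Rightarrow> bool" where
  "is_chart c \<longleftrightarrow> open (cdom c) \<and> open (cimg c) \<and>
     homeomorphism (cdom c) (cimg c) (coord c) (param c)"

definition overlap :: "('a, 'm) chart \<Rightarrow> ('a, 'm) chart \<Rightarrow> (real ^ 'm) set" where
  "overlap c c' = coord c ` (cdom c \<inter> cdom c')"

definition trans_map :: "('a, 'm) chart \<Rightarrow> ('a, 'm) chart \<Rightarrow> real ^ 'm \<Rightarrow> real ^ 'm" where
  "trans_map c c' x = coord c' (param c x)"

definition dtrans :: "('a, 'm::finite) chart \<Rightarrow> ('a, 'm) chart \<Rightarrow> real ^ 'm \<Rightarrow> real ^ 'm \<Rightarrow> real ^ 'm" where
  "dtrans c c' x = frechet_derivative (trans_map c c') (at x)"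

definition oriented_atlas :: "('a::topological_space, 'm::finite) chart set \<Rightarrow> bool" where
  "oriented_atlas \<A> \<longleftrightarrow>
     (\<forall>c\<in>\<A>. is_chart c) \<and> (\<Union>c\<in>\<A>. cdom c) = UNIV \<and>
     (\<forall>c\<in>\<A>. \<forall>c'\<in>\<A>. smooth_on (overlap c c') (trans_map c c') \<and>
        (\<forall>x\<in>overlap c c'. det (matrix (dtrans c c' x)) > 0))"

definition gprod :: "('a, 'm::finite) spacetime \<Rightarrow> ('a, 'm) chart \<Rightarrow> real ^ 'm \<Rightarrow> real ^ 'm \<Rightarrow> real ^ 'm \<Rightarrow> real" where
  "gprod M c x v w = v \<bullet> (metric M c x *v w)"

definition lorentzian_matrix :: "real ^ 'm ^ 'm::finite \<Rightarrow> bool" where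
  "lorentzian_matrix G \<longleftrightarrow>
     (\<exists>(P :: real ^ 'm ^ 'm) i0. invertible P \<and>
        transpose P ** G ** P = (\<chi> i j. if i = j then (if i = i0 then - 1 else 1) else 0))"

definition lorentzian_metric :: "('a::topological_space, 'm::finite) spacetime \<Rightarrow> bool" where
  "lorentzian_metric M \<longleftrightarrow>
     (\<forall>c\<in>atlas M. smooth_on (cimg c) (metric M c) \<and>
        (\<forall>x\<in>cimg c. lorentzian_matrix (metric M c x))) \<and>
     (\<forall>c\<in>atlas M. \<forall>c'\<in>atlas M. \<forall>x\<in>overlap c c'. \<forall>v w.
        gprod M c x v w = gprod M c' (trans_map c c' x) (dtrans c c' x v) (dtrans c c' x w))"

definition time_orientation :: "('a::topological_space, 'm::finite) spacetime \<Rightarrow> bool" where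
  "time_orientation M \<longleftrightarrow>
     (\<forall>c\<in>atlas M. smooth_on (cimg c) (tfield M c) \<and>
        (\<forall>x\<in>cimg c. gprod M c x (tfield M c x) (tfield M c x) < 0)) \<and>
     (\<forall>c\<in>atlas M. \<forall>c'\<in>atlas M. \<forall>x\<in>overlap c c'.
        tfield M c' (trans_map c c' x) = dtrans c c' x (tfield M c x))"

definition oriented_lorentzian_manifold :: "('a::topological_space, 'm::finite) spacetime \<Rightarrow> bool" where
  "oriented_lorentzian_manifold M \<longleftrightarrow>
     oriented_atlas (atlas M) \<and> lorentzian_metric M \<and> time_orientation M"


subsection \<open>Causality\<close>

definition smooth_curve :: "('a::topological_space, 'm::finite) spacetime \<Rightarrow> real set \<Rightarrow> (real \<Rightarrow> 'a) \<Rightarrow> bool" where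
  "smooth_curve M J \<gamma> \<longleftrightarrow> open J \<and> continuous_on J \<gamma> \<and>
     (\<forall>c\<in>atlas M. smooth_on (J \<inter> \<gamma> -` cdom c) (coord c \<circ> \<gamma>))"

definition velocity :: "('a, 'm::finite) chart \<Rightarrow> (real \<Rightarrow> 'a) \<Rightarrow> real \<Rightarrow> real ^ 'm" where
  "velocity c \<gamma> t = vector_derivative (coord c \<circ> \<gamma>) (at t)"

definition future_causal_at :: "('a, 'm::finite) spacetime \<Rightarrow> (real \<Rightarrow> 'a) \<Rightarrow> real \<Rightarrow> bool" where
  "future_causal_at M \<gamma> t \<longleftrightarrow>
     (\<forall>c\<in>atlas M. \<gamma> t \<in> cdom c \<longrightarrow>
        (let x = coord c (\<gamma> t); v = velocity c \<gamma> t in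
           v \<noteq> 0 \<and> gprod M c x v v \<le> 0 \<and> gprod M c x v (tfield M c x) < 0))"

definition future_timelike_at :: "('a, 'm::finite) spacetime \<Rightarrow> (real \<Rightarrow> 'a) \<Rightarrow> real \<Rightarrow> bool" where
  "future_timelike_at M \<gamma> t \<longleftrightarrow>
     (\<forall>c\<in>atlas M. \<gamma> t \<in> cdom c \<longrightarrow>
        (let x = coord c (\<gamma> t); v = velocity c \<gamma> t in
           gprod M c x v v < 0 \<and> gprod M c x v (tfield M c x) < 0))"

definition causal_segments :: "('a::topological_space, 'm::finite) spacetime \<Rightarrow> ('a \<times> 'a) set" where
  "causal_segments M =
     {(p, q). \<exists>J \<gamma> a b. smooth_curve M J \<gamma> \<and> a < b \<and> {a..b} \<subseteq> J \<and> \<gamma> a = p \<and> \<gamma> b = q \<and>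
        (\<forall>t\<in>{a..b}. future_causal_at M \<gamma> t)}"

text \<open>Concatenations of smooth causal segments are the piecewise smooth causal curves.\<close>

definition causal_future :: "('a::topological_space, 'm::finite) spacetime \<Rightarrow> 'a \<Rightarrow> 'a set" where
  "causal_future M p = {q. (p, q) \<in> (causal_segments M)\<^sup>*}"

definition causal_past :: "('a::topological_space, 'm::finite) spacetime \<Rightarrow> 'a \<Rightarrow> 'a set" where
  "causal_past M q = {p. (p, q) \<in> (causal_segments M)\<^sup>*}"

text \<open>No closed causal curves and compact causal diamonds.\<close>

definition globally_hyperbolic :: "('a::topological_space, 'm::finite) spacetime \<Rightarrow> bool" where
  "globally_hyperbolic M \<longleftrightarrow>
     oriented_lorentzian_manifold M \<and>
     acyclic (causal_segments M) \<and>
     (\<forall>p q. compact (causal_future M p \<inter> causal_past M q))"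

text \<open>
  Every open interval is diffeomorphic to the real line, so it is enough to consider curves
  defined on the latter; past directed curves are covered by reversing the parameter.
\<close>

definition inextendible_timelike_curve :: "('a::topological_space, 'm::finite) spacetime \<Rightarrow> (real \<Rightarrow> 'a) \<Rightarrow> bool" where
  "inextendible_timelike_curve M \<gamma> \<longleftrightarrow>
     smooth_curve M UNIV \<gamma> \<and> (\<forall>t. future_timelike_at M \<gamma> t) \<and>
     \<not> (\<exists>p. (\<gamma> \<longlongrightarrow> p) at_top) \<and> \<not> (\<exists>p. (\<gamma> \<longlongrightarrow> p) at_bot)"

definition cauchy_surface :: "('a::topological_space, 'm::finite) spacetime \<Rightarrow> 'a set \<Rightarrow> bool" where
  "cauchy_surface M \<Sigma> \<longleftrightarrow> (\<forall>\<gamma>. inextendible_timelike_curve M \<gamma> \<longrightarrow> (\<exists>!t. \<gamma> t \<in> \<Sigma>))"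

text \<open>Embedded hypersurfaces, locally the zero set of a submersion, with Riemannian induced metric.\<close>

definition spacelike_hypersurface :: "('a::topological_space, 'm::finite) spacetime \<Rightarrow> 'a set \<Rightarrow> bool" where
  "spacelike_hypersurface M \<Sigma> \<longleftrightarrow>
     (\<forall>p\<in>\<Sigma>. \<exists>c\<in>atlas M. p \<in> cdom c \<and>
        (\<exists>W (f :: real ^ 'm \<Rightarrow> real). open W \<and> coord c p \<in> W \<and> W \<subseteq> cimg c \<and> smooth_on W f \<and>
          (\<forall>x\<in>W. param c x \<in> \<Sigma> \<longleftrightarrow> f x = 0) \<and>
          (\<forall>x\<in>W. f x = 0 \<longrightarrow>
             (\<exists>v. frechet_derivative f (at x) v \<noteq> 0) \<and>
             (\<forall>v. v \<noteq> 0 \<and> frechet_derivative f (at x) v = 0 \<longrightarrow> gprod M c x v v > 0))))"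


section \<open>Lie algebras\<close>

definition lie_algebra ::
  "('k::real_normed_field \<Rightarrow> 'g::real_normed_vector \<Rightarrow> 'g) \<Rightarrow> ('g \<Rightarrow> 'g \<Rightarrow> 'g) \<Rightarrow> bool" where
  "lie_algebra s br \<longleftrightarrow>
     (\<exists>B. finite_dimensional_vector_space s B) \<and>
     (\<forall>r x. s (of_real r) x = r *\<^sub>R x) \<and>
     (\<forall>x y z. br (x + y) z = br x z + br y z) \<and>
     (\<forall>x y z. br x (y + z) = br x y + br x z) \<and>
     (\<forall>a x y. br (s a x) y = s a (br x y)) \<and>
     (\<forall>a x y. br x (s a y) = s a (br x y)) \<and>
     (\<forall>x. br x x = 0) \<and>
     (\<forall>x y z. br x (br y z) + br y (br z x) + br z (br x y) = 0)"

definition lie_ideal ::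
  "('k::field \<Rightarrow> 'g::ab_group_add \<Rightarrow> 'g) \<Rightarrow> ('g \<Rightarrow> 'g \<Rightarrow> 'g) \<Rightarrow> 'g set \<Rightarrow> bool" where
  "lie_ideal s br I \<longleftrightarrow> module.subspace s I \<and> (\<forall>x. \<forall>y\<in>I. br x y \<in> I)"

primrec derived_series ::
  "('k::field \<Rightarrow> 'g::ab_group_add \<Rightarrow> 'g) \<Rightarrow> ('g \<Rightarrow> 'g \<Rightarrow> 'g) \<Rightarrow> 'g set \<Rightarrow> nat \<Rightarrow> 'g set" where
  "derived_series s br I 0 = I"
| "derived_series s br I (Suc n) =
     module.span s {br x y | x y. x \<in> derived_series s br I n \<and> y \<in> derived_series s br I n}"

definition semisimple ::
  "('k::field \<Rightarrow> 'g::ab_group_add \<Rightarrow> 'g) \<Rightarrow> ('g \<Rightarrow> 'g \<Rightarrow> 'g) \<Rightarrow> bool" where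
  "semisimple s br \<longleftrightarrow>
     (\<forall>I. lie_ideal s br I \<and> (\<exists>n. derived_series s br I n = {0}) \<longrightarrow> I = {0})"


section \<open>Lie algebra valued differential forms\<close>

text \<open>
  A form is evaluated at a chart, a point in the image of that chart and a list of tangent
  vectors in coordinates. Every \<open>p\<close>-form vanishes on all other arguments, in particular on lists
  of length different from \<open>p\<close>.
\<close>

type_synonym ('a, 'm, 'g) form = "('a, 'm) chart \<Rightarrow> real ^ 'm \<Rightarrow> (real ^ 'm) list \<Rightarrow> 'g"

definition Omega :: "('a, 'm::finite) spacetime \<Rightarrow> nat \<Rightarrow> ('a, 'm, 'g::real_normed_vector) form set" where
  "Omega M p = {\<omega>.
     (\<forall>c x vs. c \<notin> atlas M \<or> x \<notin> cimg c \<or> length vs \<noteq> p \<longrightarrow> \<omega> c x vs = 0) \<and>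
     (\<forall>c\<in>atlas M. \<forall>x\<in>cimg c.
        (\<forall>us ws. length us + 1 + length ws = p \<longrightarrow> linear (\<lambda>v. \<omega> c x (us @ [v] @ ws))) \<and>
        (\<forall>us v vs ws. \<omega> c x (us @ [v] @ vs @ [v] @ ws) = 0)) \<and>
     (\<forall>c\<in>atlas M. \<forall>vs. smooth_on (cimg c) (\<lambda>x. \<omega> c x vs)) \<and>
     (\<forall>c\<in>atlas M. \<forall>c'\<in>atlas M. \<forall>x\<in>overlap c c'. \<forall>vs.
        \<omega> c x vs = \<omega> c' (trans_map c c' x) (map (dtrans c c' x) vs))}"

definition ext_d :: "('a, 'm::finite) spacetime \<Rightarrow> ('a, 'm, 'g::real_normed_vector) form \<Rightarrow> ('a, 'm, 'g) form" where
  "ext_d M \<omega> c x vs =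
     (if c \<in> atlas M \<and> x \<in> cimg c
      then \<Sum>i<length vs. (- 1) ^ i *\<^sub>R
             frechet_derivative (\<lambda>y. \<omega> c y (take i vs @ drop (Suc i) vs)) (at x) (vs ! i)
      else 0)"

text \<open>
  The bracket of a \<open>p\<close>-form and a \<open>q\<close>-form, i.e. the wedge product combined with the Lie bracket:
  a sum over shuffles, each given by the set of the \<open>p\<close> positions that go to the first form.
\<close>

definition shuffle_sign :: "nat set \<Rightarrow> nat \<Rightarrow> real" where
  "shuffle_sign I n = (- 1) ^ card {(i, j). i \<in> I \<and> j \<in> {..<n} - I \<and> j < i}"

definition form_bracket ::
  "('g \<Rightarrow> 'g \<Rightarrow> 'g::real_normed_vector) \<Rightarrow> nat \<Rightarrow> nat \<Rightarrow> ('a, 'm, 'g) form \<Rightarrow> ('a, 'm, 'g) form \<Rightarrow> ('a, 'm, 'g) form" where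
  "form_bracket br p q \<alpha> \<beta> c x vs =
     (if length vs = p + q
      then \<Sum>I\<in>{I. I \<subseteq> {..<p + q} \<and> card I = p}.
             shuffle_sign I (p + q) *\<^sub>R br (\<alpha> c x (nths vs I)) (\<beta> c x (nths vs (- I)))
      else 0)"

text \<open>The metric volume form; the list of arguments supplies the columns of the matrix.\<close>

definition vol ::
  "('a, 'm::{finite,linorder}) spacetime \<Rightarrow> ('a, 'm) chart \<Rightarrow> (real, 'm) vec \<Rightarrow> (real, 'm) vec list \<Rightarrow> real" where
  "vol M c x vs = sqrt \<bar>det (metric M c x)\<bar> * det (\<chi> i j. (vs ! card {k. k < j}) $ i)"

text \<open>
  The Hodge operator on \<open>p\<close>-forms, normalised by
  \<open>\<alpha> \<and> \<star>\<beta> = \<langle>\<alpha>, \<beta>\<rangle> vol\<close>. The vector \<open>matrix_inv G *v axis i 1\<close> is the \<open>i\<close>-th coordinate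
  covector with its index raised.
\<close>

definition hodge ::
  "('a, 'm::{finite,linorder}) spacetime \<Rightarrow> nat \<Rightarrow> ('a, 'm, 'g::real_normed_vector) form \<Rightarrow> ('a, 'm, 'g) form" where
  "hodge M p \<omega> c x ws =
     (if c \<in> atlas M \<and> x \<in> cimg c \<and> length ws + p = CARD('m)
      then (1 / fact p) *\<^sub>R
        (\<Sum>is\<in>{is :: 'm list. length is = p}.
           vol M c x (map (\<lambda>i. axis i 1) is @ ws) *\<^sub>R
           \<omega> c x (map (\<lambda>i. matrix_inv (metric M c x) *v axis i 1) is))
      else 0)"


section \<open>Graded locally convex spaces\<close>

text \<open>
  A bounded graded locally convex space over a field \<open>'k\<close>, real or complex: the total space, its homogeneous
  components (of which it is the finite direct sum), and a family of seminorms generating the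
  topology.
\<close>

record ('k, 'v) glcs =
  scl :: "'k \<Rightarrow> 'v \<Rightarrow> 'v"
  total :: "'v set"
  homog :: "int \<Rightarrow> 'v set"
  seminorms :: "('v \<Rightarrow> real) set"

text \<open>Continuity of a linear map for the locally convex topologies generated by \<open>P\<close> and \<open>Q\<close>.\<close>

definition seminorm_continuous ::
  "'x set \<Rightarrow> ('x \<Rightarrow> real) set \<Rightarrow> ('y \<Rightarrow> real) set \<Rightarrow> ('x \<Rightarrow> 'y) \<Rightarrow> bool" where
  "seminorm_continuous X P Q f \<longleftrightarrow>
     (\<forall>q\<in>Q. \<exists>F C. finite F \<and> F \<subseteq> P \<and> (\<forall>x\<in>X. q (f x) \<le> C * (\<Sum>p\<in>F. p x)))"

definition bounded_subset :: "('k, 'v) glcs \<Rightarrow> 'v set \<Rightarrow> bool" where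
  "bounded_subset V B \<longleftrightarrow> B \<subseteq> total V \<and> (\<forall>p\<in>seminorms V. bdd_above (p ` B))"

text \<open>
  Continuous linear functionals are extended by zero outside of the total space, so that they
  form an honest set of functions. The strong dual carries the topology of uniform convergence
  on bounded subsets and the grading \<open>(V')\<^sup>i = (V\<^sup>-\<^sup>i)'\<close>.
\<close>

definition functionals :: "('k::real_normed_field, 'v::ab_group_add) glcs \<Rightarrow> ('v \<Rightarrow> 'k) set" where
  "functionals V = {\<phi>.
     (\<forall>x. x \<notin> total V \<longrightarrow> \<phi> x = 0) \<and>
     (\<forall>x\<in>total V. \<forall>y\<in>total V. \<phi> (x + y) = \<phi> x + \<phi> y) \<and>
     (\<forall>a. \<forall>x\<in>total V. \<phi> (scl V a x) = a * \<phi> x) \<and>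
     seminorm_continuous (total V) (seminorms V) {norm} \<phi>}"

definition strong_dual :: "('k::real_normed_field, 'v::ab_group_add) glcs \<Rightarrow> ('k, 'v \<Rightarrow> 'k) glcs" where
  "strong_dual V = \<lparr>
     scl = (\<lambda>a \<phi> x. a * \<phi> x),
     total = functionals V,
     homog = (\<lambda>i. {\<phi> \<in> functionals V. \<forall>j. j \<noteq> - i \<longrightarrow> (\<forall>x\<in>homog V j. \<phi> x = 0)}),
     seminorms = {\<lambda>\<phi>. (SUP x\<in>B. norm (\<phi> x)) | B. bounded_subset V B \<and> B \<noteq> {}} \<rparr>"

definition koszul :: "int \<Rightarrow> int \<Rightarrow> 'k::real_normed_field" where
  "koszul i j = (if odd i \<and> odd j then - 1 else 1)"


subsection \<open>Completed projective tensor powers and the completed symmetric algebra\<close>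

text \<open>
  \<open>form_ball V n P C\<close> consists of the \<open>n\<close>-linear forms (extended by zero) that are bounded by
  \<open>C\<close> times the \<open>n\<close>-th power of the continuous seminorm \<open>\<Sum>p\<in>P. p\<close>. The projective tensor
  seminorm of the latter is the supremum over \<open>form_ball V n P 1\<close>.
\<close>

definition form_ball ::
  "('k::real_normed_field, 'v::ab_group_add) glcs \<Rightarrow> nat \<Rightarrow> ('v \<Rightarrow> real) set \<Rightarrow> real \<Rightarrow> ('v list \<Rightarrow> 'k) set" where
  "form_ball V n P C = {\<beta>.
     (\<forall>vs. length vs \<noteq> n \<or> \<not> set vs \<subseteq> total V \<longrightarrow> \<beta> vs = 0) \<and>
     (\<forall>us ws. length us + 1 + length ws = n \<and> set us \<subseteq> total V \<and> set ws \<subseteq> total V \<longrightarrow>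
        (\<forall>v\<in>total V. \<forall>w\<in>total V. \<beta> (us @ [v + w] @ ws) = \<beta> (us @ [v] @ ws) + \<beta> (us @ [w] @ ws)) \<and>
        (\<forall>a. \<forall>v\<in>total V. \<beta> (us @ [scl V a v] @ ws) = a * \<beta> (us @ [v] @ ws))) \<and>
     (\<forall>vs. length vs = n \<and> set vs \<subseteq> total V \<longrightarrow>
        norm (\<beta> vs) \<le> C * prod_list (map (\<lambda>v. \<Sum>p\<in>P. p v) vs))}"

definition cont_forms :: "('k::real_normed_field, 'v::ab_group_add) glcs \<Rightarrow> nat \<Rightarrow> ('v list \<Rightarrow> 'k) set" where
  "cont_forms V n = (\<Union>P\<in>{P. finite P \<and> P \<subseteq> seminorms V}. \<Union>C. form_ball V n P C)"

definition graded_symmetric :: "('k::real_normed_field, 'v) glcs \<Rightarrow> ('v list \<Rightarrow> 'k) \<Rightarrow> bool" where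
  "graded_symmetric V \<beta> \<longleftrightarrow>
     (\<forall>us ws i j. \<forall>x\<in>homog V i. \<forall>y\<in>homog V j.
        \<beta> (us @ [x, y] @ ws) = koszul i j * \<beta> (us @ [y, x] @ ws))"

definition sym_forms :: "('k::real_normed_field, 'v::ab_group_add) glcs \<Rightarrow> nat \<Rightarrow> ('v list \<Rightarrow> 'k) set" where
  "sym_forms V n = {\<beta> \<in> cont_forms V n. graded_symmetric V \<beta>}"

text \<open>
  The algebraic tensor power is realised inside the functions on continuous \<open>n\<close>-linear forms
  (its topological dual) by \<open>v\<^sub>1 \<otimes> \<dots> \<otimes> v\<^sub>n \<mapsto> (\<lambda>\<beta>. \<beta> [v\<^sub>1, \<dots>, v\<^sub>n])\<close>; this is
  faithful because the spaces are Hausdorff.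
\<close>

definition pure_tensor ::
  "('k::real_normed_field, 'v::ab_group_add) glcs \<Rightarrow> 'v list \<Rightarrow> ('v list \<Rightarrow> 'k) \<Rightarrow> 'k" where
  "pure_tensor V vs \<beta> = (if \<beta> \<in> cont_forms V (length vs) then \<beta> vs else 0)"

definition homog_lists :: "('k, 'v) glcs \<Rightarrow> nat \<Rightarrow> int \<Rightarrow> 'v list set" where
  "homog_lists V n d =
     {vs. \<exists>ds. length vs = n \<and> list_all2 (\<lambda>v i. v \<in> homog V i) vs ds \<and> sum_list ds = d}"

definition alg_tensor_power ::
  "('k::real_normed_field, 'v::ab_group_add) glcs \<Rightarrow> nat \<Rightarrow> int \<Rightarrow> (('v list \<Rightarrow> 'k) \<Rightarrow> 'k) set" where
  "alg_tensor_power V n d =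
     {\<lambda>\<beta>. \<Sum>j<N. a j * pure_tensor V (vs j) \<beta> | (N :: nat) a vs. \<forall>j<N. vs j \<in> homog_lists V n d}"

text \<open>
  The degree \<open>d\<close> part of the completed projective tensor power. Functions on continuous
  \<open>n\<close>-linear forms that are bounded on each ball form a complete space for uniform convergence
  on the balls, and this topology induces the projective topology on the algebraic tensor power;
  so the completion of the latter is its closure.
\<close>

definition tensor_power ::
  "('k::real_normed_field, 'v::ab_group_add) glcs \<Rightarrow> nat \<Rightarrow> int \<Rightarrow> (('v list \<Rightarrow> 'k) \<Rightarrow> 'k) set" where
  "tensor_power V n d = {t.
     (\<forall>\<beta>. \<beta> \<notin> cont_forms V n \<longrightarrow> t \<beta> = 0) \<and>
     (\<forall>P C e. finite P \<and> P \<subseteq> seminorms V \<and> e > 0 \<longrightarrow>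
        (\<exists>u\<in>alg_tensor_power V n d. \<forall>\<beta>\<in>form_ball V n P C. norm (t \<beta> - u \<beta>) \<le> e))}"

text \<open>
  Coinvariants of the symmetric group: two tensors have the same class if and only if they agree
  on all invariant, i.e. graded symmetric, forms. Hence the quotient map is restriction to these.
\<close>

definition sym_class ::
  "('k::real_normed_field, 'v::ab_group_add) glcs \<Rightarrow> nat \<Rightarrow> (('v list \<Rightarrow> 'k) \<Rightarrow> 'k) \<Rightarrow> ('v list \<Rightarrow> 'k) \<Rightarrow> 'k" where
  "sym_class V n t = (\<lambda>\<beta>. if \<beta> \<in> sym_forms V n then t \<beta> else 0)"

definition sym_power ::
  "('k::real_normed_field, 'v::ab_group_add) glcs \<Rightarrow> nat \<Rightarrow> int \<Rightarrow> (('v list \<Rightarrow> 'k) \<Rightarrow> 'k) set" where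
  "sym_power V n d = sym_class V n ` tensor_power V n d"

definition sym_power_seminorm ::
  "('k::real_normed_field, 'v::ab_group_add) glcs \<Rightarrow> nat \<Rightarrow> ('v \<Rightarrow> real) set \<Rightarrow> (('v list \<Rightarrow> 'k) \<Rightarrow> 'k) \<Rightarrow> real" where
  "sym_power_seminorm V n P t = (SUP \<beta>\<in>form_ball V n P 1 \<inter> sym_forms V n. norm (t \<beta>))"

text \<open>The completed symmetric algebra: the locally convex direct sum of the symmetric powers.\<close>

type_synonym ('k, 'v) symalg = "nat \<Rightarrow> ('v list \<Rightarrow> 'k) \<Rightarrow> 'k"

definition Sym :: "('k::real_normed_field, 'v::ab_group_add) glcs \<Rightarrow> int \<Rightarrow> ('k, 'v) symalg set" where
  "Sym V d = {T. (\<forall>n. T n \<in> sym_power V n d) \<and> finite {n. T n \<noteq> 0}}"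

definition sym_seminorms :: "('k::real_normed_field, 'v::ab_group_add) glcs \<Rightarrow> (('k, 'v) symalg \<Rightarrow> real) set" where
  "sym_seminorms V =
     {\<lambda>T. \<Sum>n\<in>{n. T n \<noteq> 0}. r n * sym_power_seminorm V n (P n) (T n) | r P.
        \<forall>n. r n \<ge> 0 \<and> finite (P n) \<and> P n \<subseteq> seminorms V}"

definition sym_scale :: "'k::real_normed_field \<Rightarrow> ('k, 'v) symalg \<Rightarrow> ('k, 'v) symalg" where
  "sym_scale a T = (\<lambda>n \<beta>. a * T n \<beta>)"

definition sym_gen :: "('k::real_normed_field, 'v::ab_group_add) glcs \<Rightarrow> 'v \<Rightarrow> ('k, 'v) symalg" where
  "sym_gen V v = (\<lambda>n. if n = 1 then sym_class V 1 (pure_tensor V [v]) else 0)"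

text \<open>The product, on generators given by concatenation of lists.\<close>

definition sym_mult ::
  "('k::real_normed_field, 'v::ab_group_add) glcs \<Rightarrow> ('k, 'v) symalg \<Rightarrow> ('k, 'v) symalg \<Rightarrow> ('k, 'v) symalg" where
  "sym_mult V T S = (\<lambda>n \<beta>. if \<beta> \<in> sym_forms V n
     then \<Sum>i\<le>n. T i (\<lambda>vs. S (n - i) (\<lambda>ws. \<beta> (vs @ ws))) else 0)"


subsection \<open>Formal power series in \<open>\<lambda>\<close>\<close>

definition Sym_ps :: "('k::real_normed_field, 'v::ab_group_add) glcs \<Rightarrow> int \<Rightarrow> (nat \<Rightarrow> ('k, 'v) symalg) set" where
  "Sym_ps V d = {f. \<forall>n. f n \<in> Sym V d}"

definition ps_const :: "('k::real_normed_field, 'v) symalg \<Rightarrow> nat \<Rightarrow> ('k, 'v) symalg" where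
  "ps_const T = (\<lambda>n. if n = 0 then T else 0)"

definition ps_scale :: "(nat \<Rightarrow> 'k::real_normed_field) \<Rightarrow> (nat \<Rightarrow> ('k, 'v) symalg) \<Rightarrow> nat \<Rightarrow> ('k, 'v) symalg" where
  "ps_scale a f = (\<lambda>n. \<Sum>i\<le>n. sym_scale (a i) (f (n - i)))"

definition ps_mult ::
  "('k::real_normed_field, 'v::ab_group_add) glcs \<Rightarrow> (nat \<Rightarrow> ('k, 'v) symalg) \<Rightarrow> (nat \<Rightarrow> ('k, 'v) symalg) \<Rightarrow> nat \<Rightarrow> ('k, 'v) symalg" where
  "ps_mult V f g = (\<lambda>n. \<Sum>i\<le>n. sym_mult V (f i) (g (n - i)))"

definition ps_seminorms :: "('k::real_normed_field, 'v::ab_group_add) glcs \<Rightarrow> ((nat \<Rightarrow> ('k, 'v) symalg) \<Rightarrow> real) set" where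
  "ps_seminorms V = {\<lambda>f. q (f n) | q n. q \<in> sym_seminorms V}"

text \<open>Continuous linear derivations of degree 1, linear over formal power series.\<close>

definition cont_derivation ::
  "('k::real_normed_field, 'v::ab_group_add) glcs \<Rightarrow> ((nat \<Rightarrow> ('k, 'v) symalg) \<Rightarrow> (nat \<Rightarrow> ('k, 'v) symalg)) \<Rightarrow> bool" where
  "cont_derivation V D \<longleftrightarrow>
     (\<forall>d. \<forall>f\<in>Sym_ps V d. D f \<in> Sym_ps V (d + 1)) \<and>
     (\<forall>d. \<forall>f\<in>Sym_ps V d. \<forall>g\<in>Sym_ps V d. D (f + g) = D f + D g) \<and>
     (\<forall>d a. \<forall>f\<in>Sym_ps V d. D (ps_scale a f) = ps_scale a (D f)) \<and>
     (\<forall>d e. \<forall>f\<in>Sym_ps V d. \<forall>g\<in>Sym_ps V e.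
        D (ps_mult V f g) =
          ps_mult V (D f) g + ps_scale (\<lambda>n. if n = 0 then koszul 1 d else 0) (ps_mult V f (D g))) \<and>
     (\<forall>d. seminorm_continuous (Sym_ps V d) (ps_seminorms V) (ps_seminorms V) D)"


section \<open>Chevalley-Eilenberg differential and Moller maps\<close>

text \<open>
  For \<open>\<phi>\<^sub>1, \<dots>, \<phi>\<^sub>n\<close> in the dual and homogeneous \<open>x\<^sub>1, \<dots>, x\<^sub>n\<close> of degrees \<open>ds\<close>, the
  value of the functional \<open>\<Sum>\<sigma>. (\<phi>\<^sub>1 \<otimes> \<dots> \<otimes> \<phi>\<^sub>n) \<circ> \<gamma>\<^sub>\<sigma>\<close> on \<open>x\<^sub>1 \<otimes> \<dots> \<otimes> x\<^sub>n\<close>. The first sign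
  is that of the permutation action. The second one arises from moving \<open>\<phi>\<^sub>j\<close> past \<open>x\<^sub>\<sigma>\<^sub>i\<close>,
  \<open>i < j\<close>; only the component of \<open>\<phi>\<^sub>j\<close> of degree \<open>- ds ! \<sigma> j\<close> contributes.
\<close>

definition eval_form ::
  "('k::real_normed_field, 'v::ab_group_add) glcs \<Rightarrow> int list \<Rightarrow> 'v list \<Rightarrow> ('v \<Rightarrow> 'k) list \<Rightarrow> 'k" where
  "eval_form V ds xs \<phi>s =
     (let n = length xs in
      if length \<phi>s = n \<and> set \<phi>s \<subseteq> functionals V
      then \<Sum>\<sigma>\<in>{\<sigma>. \<sigma> permutes {..<n}}.
             (\<Prod>(i, j)\<in>{(i, j). i < j \<and> j < n \<and> \<sigma> j < \<sigma> i}. koszul (ds ! \<sigma> i) (ds ! \<sigma> j)) *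
             (\<Prod>(i, j)\<in>{(i, j). i < j \<and> j < n}. koszul (ds ! \<sigma> i) (- (ds ! \<sigma> j))) *
             (\<Prod>i<n. (\<phi>s ! i) (xs ! \<sigma> i))
      else 0)"

text \<open>
  \<open>is_transpose V ell n k \<phi> T\<close>: the element \<open>T\<close> of the \<open>n\<close>-th completed symmetric power of the dual
  corresponds to the functional \<open>-(-1)\<^sup>k \<phi> \<circ> \<ell>\<^sub>n\<close> on the \<open>n\<close>-th symmetric power of \<open>V\<close>.
  Pairing an element of the completed symmetric power with \<open>x\<^sub>1 \<otimes> \<dots> \<otimes> x\<^sub>n\<close> is
  evaluation at the continuous graded symmetric form \<open>eval_form V ds [x\<^sub>1, \<dots>, x\<^sub>n]\<close>.
\<close>

definition is_transpose ::
  "('k::real_normed_field, 'v::ab_group_add) glcs \<Rightarrow> (nat \<Rightarrow> 'v list \<Rightarrow> 'v) \<Rightarrow> nat \<Rightarrow> int \<Rightarrow> ('v \<Rightarrow> 'k) \<Rightarrow> ('k, 'v \<Rightarrow> 'k) symalg \<Rightarrow> bool" where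
  "is_transpose V ell n k \<phi> T \<longleftrightarrow>
     T \<in> Sym (strong_dual V) (k + 1) \<and> (\<forall>j. j \<noteq> n \<longrightarrow> T j = 0) \<and>
     (\<forall>ds xs. length xs = n \<and> list_all2 (\<lambda>x i. x \<in> homog V i) xs ds \<longrightarrow>
        T n (eval_form V ds xs) = - (if even k then 1 else - 1) * \<phi> (ell n xs))"

definition dual_diff ::
  "('k::real_normed_field, 'v::ab_group_add) glcs \<Rightarrow> (nat \<Rightarrow> 'v list \<Rightarrow> 'v) \<Rightarrow> int \<Rightarrow> ('v \<Rightarrow> 'k) \<Rightarrow> ('v \<Rightarrow> 'k)" where
  "dual_diff V ell k \<phi> =
     (\<lambda>x. if x \<in> total V then - (if even k then 1 else - 1) * \<phi> (ell 1 [x]) else 0)"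

text \<open>
  The two parts \<open>\<delta>\<^sub>0\<close> and \<open>\<delta>\<close> of the Chevalley-Eilenberg differential are determined by their
  values on generators, since polynomials in these are dense.
\<close>

definition chevalley_eilenberg ::
  "('k::real_normed_field, 'v::ab_group_add) glcs \<Rightarrow> (nat \<Rightarrow> 'v list \<Rightarrow> 'v) \<Rightarrow>
   ((nat \<Rightarrow> ('k, 'v \<Rightarrow> 'k) symalg) \<Rightarrow> (nat \<Rightarrow> ('k, 'v \<Rightarrow> 'k) symalg)) \<Rightarrow>
   ((nat \<Rightarrow> ('k, 'v \<Rightarrow> 'k) symalg) \<Rightarrow> (nat \<Rightarrow> ('k, 'v \<Rightarrow> 'k) symalg)) \<Rightarrow> bool" where
  "chevalley_eilenberg V ell \<delta>0 \<delta> \<longleftrightarrow>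
     cont_derivation (strong_dual V) \<delta>0 \<and> cont_derivation (strong_dual V) \<delta> \<and>
     (\<forall>k. \<forall>\<phi>\<in>homog (strong_dual V) k.
        \<delta>0 (ps_const (sym_gen (strong_dual V) \<phi>)) =
          ps_const (sym_gen (strong_dual V) (dual_diff V ell k \<phi>)) \<and>
        \<delta> (ps_const (sym_gen (strong_dual V) \<phi>)) 0 = 0 \<and>
        (\<forall>n\<ge>2. is_transpose V ell n k \<phi> (\<delta> (ps_const (sym_gen (strong_dual V) \<phi>)) (n - 1))))"

definition ps_operator ::
  "(nat \<Rightarrow> ('k::real_normed_field, 'v) symalg \<Rightarrow> ('k, 'v) symalg) \<Rightarrow> (nat \<Rightarrow> ('k, 'v) symalg) \<Rightarrow> nat \<Rightarrow> ('k, 'v) symalg" where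
  "ps_operator K f = (\<lambda>n. \<Sum>i\<le>n. K i (f (n - i)))"

text \<open>Below, \<open>V\<close> plays the role of the dual of the field complex.\<close>

definition moller_map ::
  "('k::real_normed_field, 'v::ab_group_add) glcs \<Rightarrow>
   ((nat \<Rightarrow> ('k, 'v) symalg) \<Rightarrow> (nat \<Rightarrow> ('k, 'v) symalg)) \<Rightarrow>
   ((nat \<Rightarrow> ('k, 'v) symalg) \<Rightarrow> (nat \<Rightarrow> ('k, 'v) symalg)) \<Rightarrow>
   (nat \<Rightarrow> ('k, 'v) symalg \<Rightarrow> ('k, 'v) symalg) \<Rightarrow> bool" where
  "moller_map V \<delta>0 \<delta> K \<longleftrightarrow>
     (\<forall>n d. (\<forall>T\<in>Sym V d. K n T \<in> Sym V d) \<and>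
            (\<forall>T\<in>Sym V d. \<forall>S\<in>Sym V d. K n (T + S) = K n T + K n S) \<and>
            (\<forall>a. \<forall>T\<in>Sym V d. K n (sym_scale a T) = sym_scale a (K n T))) \<and>
     (\<forall>d. \<forall>T\<in>Sym V d. K 0 T = T) \<and>
     (\<forall>d. \<forall>f\<in>Sym_ps V d.
        ps_operator K (\<delta>0 f) = \<delta>0 (ps_operator K f) + \<delta> (ps_operator K f))"


section \<open>The Yang-Mills complex and its brackets\<close>

text \<open>
  Elements of the total space are families indexed by the degree: the components of a field
  \<open>v\<close> are \<open>c = v (- 1)\<close>, \<open>A = v 0\<close>, \<open>A\<^sup>\<ddagger> = v 1\<close> and \<open>c\<^sup>\<ddagger> = v 2\<close>.
\<close>

type_synonym ('a, 'm, 'g) field = "int \<Rightarrow> ('a, 'm, 'g) form"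

definition ym_total :: "('a, 'm::finite) spacetime \<Rightarrow> ('a, 'm, 'g::real_normed_vector) field set" where
  "ym_total M = {v. v (- 1) \<in> Omega M 0 \<and> v 0 \<in> Omega M 1 \<and>
     v 1 \<in> Omega M (CARD('m) - 1) \<and> v 2 \<in> Omega M CARD('m) \<and>
     (\<forall>i. i \<notin> {- 1, 0, 1, 2} \<longrightarrow> v i = 0)}"

text \<open>The topology is uniform convergence of all derivatives on compact subsets of charts.\<close>

definition ym_complex ::
  "('k::real_normed_field \<Rightarrow> 'g::real_normed_vector \<Rightarrow> 'g) \<Rightarrow> ('a, 'm::finite) spacetime \<Rightarrow> ('k, ('a, 'm, 'g) field) glcs" where
  "ym_complex s M = \<lparr>
     scl = (\<lambda>a v i c x vs. s a (v i c x vs)),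
     total = ym_total M,
     homog = (\<lambda>i. {v \<in> ym_total M. \<forall>j. j \<noteq> i \<longrightarrow> v j = 0}),
     seminorms = {\<lambda>v. (SUP x\<in>X. norm (iter_deriv ws (\<lambda>y. v i c y vs) x)) | i c X ws vs.
        c \<in> atlas M \<and> compact X \<and> X \<noteq> {} \<and> X \<subseteq> cimg c} \<rparr>"

definition ym_ell1 ::
  "('a, 'm::{finite,linorder}) spacetime \<Rightarrow> ('a, 'm, 'g::real_normed_vector) field \<Rightarrow> ('a, 'm, 'g) field" where
  "ym_ell1 M v = (\<lambda>i.
     if i = 0 then ext_d M (v (- 1))
     else if i = 1 then ext_d M (hodge M 2 (ext_d M (v 0)))
     else if i = 2 then ext_d M (v 1)
     else 0)"

text \<open>
  Both orders of the arguments are spelled out, with the signs of graded symmetry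
  \<open>\<ell>\<^sub>2 (y, x) = (-1)\<^bsup>\<bar>x\<bar>\<bar>y\<bar>\<^esup> \<ell>\<^sub>2 (x, y)\<close>; the only nontrivial one occurs for \<open>(c, A\<^sup>\<ddagger>)\<close>.
\<close>

definition ym_ell2 ::
  "('a, 'm::{finite,linorder}) spacetime \<Rightarrow> ('g \<Rightarrow> 'g \<Rightarrow> 'g) \<Rightarrow>
   ('a, 'm, 'g::real_normed_vector) field \<Rightarrow> ('a, 'm, 'g) field \<Rightarrow> ('a, 'm, 'g) field" where
  "ym_ell2 M br v w = (\<lambda>i.
     let m = CARD('m); B = form_bracket br in
     if i = - 1 then - B 0 0 (v (- 1)) (w (- 1))
     else if i = 0 then B 1 0 (v 0) (w (- 1)) + B 1 0 (w 0) (v (- 1))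
     else if i = 1 then
       - B (m - 1) 0 (v 1) (w (- 1)) + B (m - 1) 0 (w 1) (v (- 1)) +
       (ext_d M (hodge M 2 (B 1 1 (v 0) (w 0))) +
        B 1 (m - 2) (v 0) (hodge M 2 (ext_d M (w 0))) +
        B 1 (m - 2) (w 0) (hodge M 2 (ext_d M (v 0))))
     else if i = 2 then
       B m 0 (v 2) (w (- 1)) + B m 0 (w 2) (v (- 1)) +
       B 1 (m - 1) (v 0) (w 1) + B 1 (m - 1) (w 0) (v 1)
     else 0)"

definition ym_ell3 ::
  "('a, 'm::{finite,linorder}) spacetime \<Rightarrow> ('g \<Rightarrow> 'g \<Rightarrow> 'g) \<Rightarrow>
   ('a, 'm, 'g::real_normed_vector) field \<Rightarrow> ('a, 'm, 'g) field \<Rightarrow> ('a, 'm, 'g) field \<Rightarrow> ('a, 'm, 'g) field" where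
  "ym_ell3 M br u v w = (\<lambda>i.
     let m = CARD('m); B = form_bracket br in
     if i = 1 then
       B 1 (m - 2) (u 0) (hodge M 2 (B 1 1 (v 0) (w 0))) +
       B 1 (m - 2) (v 0) (hodge M 2 (B 1 1 (w 0) (u 0))) +
       B 1 (m - 2) (w 0) (hodge M 2 (B 1 1 (u 0) (v 0)))
     else 0)"

definition ym_brackets ::
  "('a, 'm::{finite,linorder}) spacetime \<Rightarrow> ('g \<Rightarrow> 'g \<Rightarrow> 'g) \<Rightarrow>
   nat \<Rightarrow> ('a, 'm, 'g::real_normed_vector) field list \<Rightarrow> ('a, 'm, 'g) field" where
  "ym_brackets M br n xs =
     (if n = 1 then ym_ell1 M (xs ! 0)
      else if n = 2 then ym_ell2 M br (xs ! 0) (xs ! 1)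
      else if n = 3 then ym_ell3 M br (xs ! 0) (xs ! 1) (xs ! 2)
      else 0)"

end

theory Submission
  imports Defs
begin

text \<open>
  At first order in the formal parameter, a Moller map yields an operator \<open>K\<^sub>1\<close> with
  \<open>\<delta>\<^sub>1 \<phi> = - \<delta>\<^sub>0 (K\<^sub>1 \<phi>)\<close> for every \<open>\<delta>\<^sub>0\<close>-closed generator \<open>\<phi>\<close>. Pair both sides with
  two constant ghosts \<open>c\<^sub>1, c\<^sub>2\<close>. These are annihilated by the differential, so every
  \<open>\<delta>\<^sub>0\<close>-exact element vanishes on them, whereas \<open>\<delta>\<^sub>1 \<phi>\<close> gives \<open>\<phi> (\<ell>\<^sub>2 (c\<^sub>1, c\<^sub>2)) = - \<phi> [c\<^sub>1, c\<^sub>2]\<close>.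
  Since no fields have degree \<open>- 2\<close>, every functional of the ghosts is closed; evaluation at a point
  followed by a functional on the Lie algebra that is nonzero on a bracket gives the contradiction.
\<close>

section \<open>Tensor powers and the symmetric algebra\<close>

text \<open>Of \<open>K 1\<close> only linearity and degree are known, so \<open>K 1\<close> applied
  to a generator is just some degree 1 element of the completed symmetric algebra, possibly with
  several weights. That \<open>\<delta>0\<close> of it vanishes on the ghosts is therefore a density
  argument: within each weight, evaluating a continuous derivation at a fixed form is continuous,
  and finite sums of products of generators are dense. On such products the Leibniz rule shows that
  a derivation sending generators to generators preserves the number of factors. Hence only products
  of two matter, and each Leibniz term contains a functional factor that vanishes on both ghosts.

  The coefficient of \<lambda> in \<open>\<delta>\<close> of the image under \<open>K\<close> also
  contains the order zero part of \<open>\<delta>\<close> on the \<open>K 1\<close> term. That part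
  vanishes on generators, and the same density argument removes it. Constants have degree 0, so the
  empty product never enters in degree 1.

  The Lie algebra carries an arbitrary norm. Automatic continuity of linear maps on it makes
  evaluation at a point a continuous functional and makes scalar multiplication preserve smooth
  forms.\<close>

definition pure_sym :: "('k::real_normed_field, 'v::ab_group_add) glcs \<Rightarrow> 'v list \<Rightarrow> ('k, 'v) symalg" where
  "pure_sym V vs = (\<lambda>n. if n = length vs then sym_class V n (pure_tensor V vs) else 0)"

definition weight_part :: "nat \<Rightarrow> (('v list \<Rightarrow> 'k) \<Rightarrow> 'k) \<Rightarrow> ('k::real_normed_field, 'v) symalg" where
  "weight_part n t = (\<lambda>k. if k = n then t else 0)"

lemma sym_gen_eq_pure_sym: "sym_gen V v = pure_sym V [v]"
  by (auto simp: sym_gen_def pure_sym_def fun_eq_iff)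

lemma pure_sym_eq_weight_part:
  "length vs = n \<Longrightarrow> pure_sym V vs = weight_part n (sym_class V n (pure_tensor V vs))"
  by (auto simp: pure_sym_def weight_part_def fun_eq_iff)

lemma zero_in_form_ball: "(\<And>p v. p \<in> P \<Longrightarrow> v \<in> total V \<Longrightarrow> 0 \<le> p v) \<Longrightarrow> 0 \<le> C \<Longrightarrow> 0 \<in> form_ball V n P C"
  unfolding form_ball_def
  by (auto intro!: mult_nonneg_nonneg prod_list_nonneg sum_nonneg) blast

lemma zero_in_sym_forms: "0 \<in> sym_forms V n"
proof -
  have "0 \<in> form_ball V n {} 0"
    by (rule zero_in_form_ball) auto
  then show ?thesis
    unfolding sym_forms_def cont_forms_def graded_symmetric_def by auto
qed

lemma sym_forms_subset: "\<beta> \<in> sym_forms V n \<Longrightarrow> \<beta> \<in> cont_forms V n"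
  by (simp add: sym_forms_def)

lemma pure_sym_eval:
  "\<beta> \<in> sym_forms V (length vs) \<Longrightarrow> pure_sym V vs (length vs) \<beta> = \<beta> vs"
  by (simp add: pure_sym_def sym_class_def pure_tensor_def sym_forms_subset)

lemma pure_sym_eval_zero: "pure_sym V vs n 0 = 0"
  by (simp add: pure_sym_def sym_class_def pure_tensor_def)

section \<open>Algebraic tensors and their completion\<close>

lemma pure_in_alg:
  assumes "vs \<in> homog_lists V n d"
  shows "pure_tensor V vs \<in> alg_tensor_power V n d"
  unfolding alg_tensor_power_def
proof (intro CollectI exI conjI)
  show "pure_tensor V vs = (\<lambda>\<beta>. \<Sum>j<(1::nat). 1 * pure_tensor V vs \<beta>)" by simp
  show "\<forall>j<(1::nat). vs \<in> homog_lists V n d" using assms by simp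
qed

lemma zero_in_alg: "(\<lambda>\<beta>. 0) \<in> alg_tensor_power V n d"
  unfolding alg_tensor_power_def
  by (intro CollectI exI[of _ "0::nat"] exI conjI) auto

lemma alg_add_pure:
  assumes "u \<in> alg_tensor_power V n d" "vs \<in> homog_lists V n d"
  shows "(\<lambda>\<beta>. u \<beta> + a * pure_tensor V vs \<beta>) \<in> alg_tensor_power V n d"
proof -
  obtain N b ws where u: "u = (\<lambda>\<beta>. \<Sum>j<N. b j * pure_tensor V (ws j) \<beta>)"
    and ws: "\<forall>j<(N::nat). ws j \<in> homog_lists V n d"
    using assms(1) unfolding alg_tensor_power_def by blast
  show ?thesis
    unfolding alg_tensor_power_def
  proof (intro CollectI exI conjI)
    show "(\<lambda>\<beta>. u \<beta> + a * pure_tensor V vs \<beta>) =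
        (\<lambda>\<beta>. \<Sum>j<Suc N. (b(N := a)) j * pure_tensor V ((ws(N := vs)) j) \<beta>)"
      by (simp add: u)
    show "\<forall>j<Suc N. (ws(N := vs)) j \<in> homog_lists V n d"
      using ws assms(2) by (simp add: less_Suc_eq)
  qed
qed

text \<open>Induction on the number of terms of the sum; the partial sums are themselves algebraic
  tensors, which the \<open>add\<close> case may use.\<close>

lemma alg_tensor_power_induct [consumes 1, case_names zero add]:
  assumes "u \<in> alg_tensor_power V n d"
    and "Q (\<lambda>\<beta>. 0)"
    and "\<And>u a vs. u \<in> alg_tensor_power V n d \<Longrightarrow> Q u \<Longrightarrow> vs \<in> homog_lists V n d \<Longrightarrow>
      Q (\<lambda>\<beta>. u \<beta> + a * pure_tensor V vs \<beta>)"
  shows "Q u"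
proof -
  obtain N b ws where u: "u = (\<lambda>\<beta>. \<Sum>j<N. b j * pure_tensor V (ws j) \<beta>)"
    and ws: "\<forall>j<(N::nat). ws j \<in> homog_lists V n d"
    using assms(1) unfolding alg_tensor_power_def by blast
  have "Q (\<lambda>\<beta>. \<Sum>j<k. b j * pure_tensor V (ws j) \<beta>) \<and>
      (\<lambda>\<beta>. \<Sum>j<k. b j * pure_tensor V (ws j) \<beta>) \<in> alg_tensor_power V n d" if "k \<le> N" for k
    using that
  proof (induct k)
    case 0
    show ?case using assms(2) zero_in_alg by simp
  next
    case (Suc k)
    then have "ws k \<in> homog_lists V n d" using ws by simp
    with Suc show ?case
      using assms(3)[of "\<lambda>\<beta>. \<Sum>j<k. b j * pure_tensor V (ws j) \<beta>" "ws k" "b k"]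
        alg_add_pure[of "\<lambda>\<beta>. \<Sum>j<k. b j * pure_tensor V (ws j) \<beta>" V n d "ws k" "b k"] by simp
  qed
  then show ?thesis using u by blast
qed

lemma alg_add_scale:
  assumes "u \<in> alg_tensor_power V n d" "w \<in> alg_tensor_power V n d"
  shows "(\<lambda>\<beta>. u \<beta> + a * w \<beta>) \<in> alg_tensor_power V n d"
  using assms(2)
proof (induct w rule: alg_tensor_power_induct)
  case zero
  then show ?case using assms(1) by simp
next
  case (add w b vs)
  have "(\<lambda>\<beta>. (u \<beta> + a * w \<beta>) + (a * b) * pure_tensor V vs \<beta>) \<in> alg_tensor_power V n d"
    using add by (intro alg_add_pure)
  then show ?case by (simp add: algebra_simps)
qed

lemma alg_outside:
  assumes "u \<in> alg_tensor_power V n d" "\<beta> \<notin> cont_forms V n"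
  shows "u \<beta> = 0"
  using assms(1)
proof (induct u rule: alg_tensor_power_induct)
  case (add w b vs)
  then have "length vs = n" by (auto simp: homog_lists_def)
  with add show ?case using assms(2) by (simp add: pure_tensor_def)
qed simp

lemma alg_in_tensor_power:
  assumes "u \<in> alg_tensor_power V n d"
  shows "u \<in> tensor_power V n d"
proof -
  have "\<exists>w\<in>alg_tensor_power V n d. \<forall>\<beta>\<in>form_ball V n P C. norm (u \<beta> - w \<beta>) \<le> e" if "e > 0" for P C e
    using that assms by (intro bexI[of _ u]) auto
  then show ?thesis
    unfolding tensor_power_def using alg_outside[OF assms] by blast
qed

lemma tensor_power_approx:
  assumes "t \<in> tensor_power V n d" "finite P" "P \<subseteq> seminorms V" "e > 0"
  obtains u where "u \<in> alg_tensor_power V n d" "\<forall>\<beta>\<in>form_ball V n P C. norm (t \<beta> - u \<beta>) \<le> e"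
  using assms unfolding tensor_power_def by blast

lemma tensor_power_add_scale:
  assumes "t \<in> tensor_power V n d" "w \<in> tensor_power V n d"
  shows "(\<lambda>\<beta>. t \<beta> + a * w \<beta>) \<in> tensor_power V n d"
  unfolding tensor_power_def
proof (intro CollectI conjI allI impI)
  fix \<beta> assume "\<beta> \<notin> cont_forms V n"
  then show "t \<beta> + a * w \<beta> = 0" using assms by (simp add: tensor_power_def)
next
  fix P C and e :: real assume P: "finite P \<and> P \<subseteq> seminorms V \<and> 0 < e"
  \<comment> \<open>An error \<open>e'\<close> for \<open>t\<close> and an error
    \<open>norm a * e'\<close> for the multiple of \<open>w\<close> add up to
    \<open>e\<close>.\<close>
  define e' where "e' = e / (1 + norm a)"
  have a1: "1 + norm a > 0" by (rule add_pos_nonneg) auto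
  then have "e' * (1 + norm a) = e" by (simp add: e'_def)
  then have e'_sum: "e' + norm a * e' = e" by (simp only: distrib_left mult_1_right mult.commute)
  have e': "e' > 0" using a1 P by (simp add: e'_def)
  obtain t' where t': "t' \<in> alg_tensor_power V n d" "\<forall>\<beta>\<in>form_ball V n P C. norm (t \<beta> - t' \<beta>) \<le> e'"
    by (rule tensor_power_approx[OF assms(1) _ _ e', of P C]) (use P in auto)
  obtain w' where w': "w' \<in> alg_tensor_power V n d" "\<forall>\<beta>\<in>form_ball V n P C. norm (w \<beta> - w' \<beta>) \<le> e'"
    by (rule tensor_power_approx[OF assms(2) _ _ e', of P C]) (use P in auto)
  show "\<exists>u\<in>alg_tensor_power V n d. \<forall>\<beta>\<in>form_ball V n P C. norm (t \<beta> + a * w \<beta> - u \<beta>) \<le> e"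
  proof (intro bexI[of _ "\<lambda>\<beta>. t' \<beta> + a * w' \<beta>"] ballI alg_add_scale t' w')
    fix \<beta> assume \<beta>: "\<beta> \<in> form_ball V n P C"
    have "norm (t \<beta> + a * w \<beta> - (t' \<beta> + a * w' \<beta>)) = norm ((t \<beta> - t' \<beta>) + a * (w \<beta> - w' \<beta>))"
      by (simp add: algebra_simps)
    also have "\<dots> \<le> norm (t \<beta> - t' \<beta>) + norm a * norm (w \<beta> - w' \<beta>)"
      by (metis norm_triangle_ineq norm_mult)
    also have "\<dots> \<le> e' + norm a * e'"
      using \<beta> t'(2) w'(2) by (intro add_mono mult_left_mono) auto
    finally show "norm (t \<beta> + a * w \<beta> - (t' \<beta> + a * w' \<beta>)) \<le> e" using e'_sum by simp
  qed
qed

lemma sym_power_add_scale: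
  assumes "t \<in> sym_power V n d" "w \<in> sym_power V n d"
  shows "(\<lambda>\<beta>. t \<beta> + a * w \<beta>) \<in> sym_power V n d"
proof -
  obtain t' w' where "t = sym_class V n t'" "w = sym_class V n w'"
    and tw: "t' \<in> tensor_power V n d" "w' \<in> tensor_power V n d"
    using assms unfolding sym_power_def by blast
  then have "(\<lambda>\<beta>. t \<beta> + a * w \<beta>) = sym_class V n (\<lambda>\<beta>. t' \<beta> + a * w' \<beta>)"
    by (auto simp: sym_class_def)
  then show ?thesis
    using tensor_power_add_scale[OF tw] unfolding sym_power_def by blast
qed

lemma zero_in_sym_power: "0 \<in> sym_power V n d"
proof -
  have "sym_class V n (\<lambda>\<beta>. 0) \<in> sym_power V n d"
    unfolding sym_power_def by (intro imageI alg_in_tensor_power zero_in_alg)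
  moreover have "sym_class V n (\<lambda>\<beta>. 0) = 0" by (auto simp: sym_class_def)
  ultimately show ?thesis by simp
qed

lemma sym_power_outside: "t \<in> sym_power V n d \<Longrightarrow> \<beta> \<notin> sym_forms V n \<Longrightarrow> t \<beta> = 0"
  by (auto simp: sym_power_def sym_class_def)

section \<open>Linear structure of the symmetric algebra and of power series\<close>

lemma Sym_add:
  assumes "T \<in> Sym V d" "S \<in> Sym V d"
  shows "T + S \<in> Sym V d"
  unfolding Sym_def
proof (intro CollectI conjI allI)
  fix n
  show "(T + S) n \<in> sym_power V n d"
    using sym_power_add_scale[of "T n" V n d "S n" 1] assms by (simp add: Sym_def plus_fun_def)
  have "{n. (T + S) n \<noteq> 0} \<subseteq> {n. T n \<noteq> 0} \<union> {n. S n \<noteq> 0}" by auto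
  then show "finite {n. (T + S) n \<noteq> 0}"
    by (rule finite_subset) (use assms in \<open>auto simp: Sym_def\<close>)
qed

lemma Sym_scale:
  assumes "T \<in> Sym V d"
  shows "sym_scale a T \<in> Sym V d"
  unfolding Sym_def
proof (intro CollectI conjI allI)
  fix n
  show "sym_scale a T n \<in> sym_power V n d"
    using sym_power_add_scale[of 0 V n d "T n" a] zero_in_sym_power[of V n d] assms
    by (simp add: Sym_def sym_scale_def zero_fun_def)
  have "{n. sym_scale a T n \<noteq> 0} \<subseteq> {n. T n \<noteq> 0}" by (auto simp: sym_scale_def fun_eq_iff)
  then show "finite {n. sym_scale a T n \<noteq> 0}"
    by (rule finite_subset) (use assms in \<open>auto simp: Sym_def\<close>)
qed

lemma zero_in_Sym: "0 \<in> Sym V d"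
  using zero_in_sym_power by (auto simp: Sym_def)

lemma weight_part_in_Sym: "t \<in> sym_power V n d \<Longrightarrow> weight_part n t \<in> Sym V d"
  unfolding Sym_def weight_part_def
  by (auto simp: zero_in_sym_power intro: finite_subset[of _ "{n}"])

lemma pure_sym_in_Sym:
  assumes "vs \<in> homog_lists V n d"
  shows "pure_sym V vs \<in> Sym V d"
proof -
  have "length vs = n" using assms by (auto simp: homog_lists_def)
  moreover have "sym_class V n (pure_tensor V vs) \<in> sym_power V n d"
    unfolding sym_power_def using assms by (intro imageI alg_in_tensor_power pure_in_alg)
  ultimately show ?thesis by (simp add: pure_sym_eq_weight_part weight_part_in_Sym)
qed

lemma ps_const_in_Sym_ps: "T \<in> Sym V d \<Longrightarrow> ps_const T \<in> Sym_ps V d"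
  by (simp add: Sym_ps_def ps_const_def zero_in_Sym)

lemma ps_const_add: "ps_const (T + S) = ps_const T + ps_const S"
  by (auto simp: ps_const_def)

lemma sym_scale_0 [simp]: "sym_scale 0 T = 0" "sym_scale a 0 = 0"
  by (auto simp: sym_scale_def fun_eq_iff)

lemma sym_scale_1 [simp]: "sym_scale 1 T = T"
  by (auto simp: sym_scale_def)

lemma ps_const_0 [simp]: "ps_const 0 = 0"
  by (auto simp: ps_const_def)

lemma ps_scale_const: "ps_scale (\<lambda>n. if n = 0 then a else 0) f = (\<lambda>n. sym_scale a (f n))"
proof
  fix n
  have "ps_scale (\<lambda>n. if n = 0 then a else 0) f n = (\<Sum>i\<le>n. if i = 0 then sym_scale a (f n) else 0)"
    unfolding ps_scale_def by (intro sum.cong) auto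
  also have "\<dots> = sym_scale a (f n)" by simp
  finally show "ps_scale (\<lambda>n. if n = 0 then a else 0) f n = sym_scale a (f n)" .
qed

text \<open>The scalar is the series \<lambda> itself, whose action is the shift.\<close>

lemma ps_scale_lambda:
  "ps_scale (\<lambda>n. if n = 1 then 1 else 0) f = (\<lambda>n. if n = 0 then 0 else f (n - 1))"
proof
  fix n
  have "ps_scale (\<lambda>n. if n = 1 then 1 else 0) f n = (\<Sum>i\<le>n. if i = 1 then f (n - 1) else 0)"
    unfolding ps_scale_def by (intro sum.cong) auto
  also have "\<dots> = (if n = 0 then 0 else f (n - 1))" by (auto simp: sum.delta)
  finally show "ps_scale (\<lambda>n. if n = 1 then 1 else 0) f n = (if n = 0 then 0 else f (n - 1))" .
qed

lemma ps_const_scale: "ps_const (sym_scale a T) = ps_scale (\<lambda>n. if n = 0 then a else 0) (ps_const T)"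
  unfolding ps_scale_const by (auto simp: ps_const_def)


section \<open>Continuous derivations\<close>

lemma cont_derivation_mem: "cont_derivation V D \<Longrightarrow> f \<in> Sym_ps V d \<Longrightarrow> D f \<in> Sym_ps V (d + 1)"
  and cont_derivation_add: "cont_derivation V D \<Longrightarrow> f \<in> Sym_ps V d \<Longrightarrow> g \<in> Sym_ps V d \<Longrightarrow> D (f + g) = D f + D g"
  and cont_derivation_scale: "cont_derivation V D \<Longrightarrow> f \<in> Sym_ps V d \<Longrightarrow> D (ps_scale a f) = ps_scale a (D f)"
  and cont_derivation_mult: "cont_derivation V D \<Longrightarrow> f \<in> Sym_ps V d \<Longrightarrow> g \<in> Sym_ps V e \<Longrightarrow>
        D (ps_mult V f g) =
          ps_mult V (D f) g + ps_scale (\<lambda>n. if n = 0 then koszul 1 d else 0) (ps_mult V f (D g))"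
  and cont_derivation_cont: "cont_derivation V D \<Longrightarrow>
        seminorm_continuous (Sym_ps V d) (ps_seminorms V) (ps_seminorms V) D"
  unfolding cont_derivation_def by blast+

text \<open>A series is its constant term plus \<lambda> times its shift, and linearity over power
  series pulls \<lambda> out of \<open>D\<close>. Applied again to the shift, this yields the low
  order coefficients of \<open>D g\<close>.\<close>

lemma cont_derivation_split:
  assumes D: "cont_derivation V D" and g: "g \<in> Sym_ps V d"
  shows "D g = D (ps_const (g 0)) + (\<lambda>n. if n = 0 then 0 else D (\<lambda>n. g (Suc n)) (n - 1))"
proof -
  let ?l = "\<lambda>n. if n = 1 then 1 else 0 :: 'a"
  have s: "(\<lambda>n. g (Suc n)) \<in> Sym_ps V d" using g by (simp add: Sym_ps_def)
  have l: "ps_scale ?l (\<lambda>n. g (Suc n)) \<in> Sym_ps V d"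
    using g unfolding ps_scale_lambda by (simp add: Sym_ps_def zero_in_Sym)
  have "ps_const (g 0) + ps_scale ?l (\<lambda>n. g (Suc n)) = g"
    unfolding ps_scale_lambda
  proof
    fix n show "(ps_const (g 0) + (\<lambda>n. if n = 0 then 0 else g (Suc (n - 1)))) n = g n"
      by (cases n) (simp_all add: ps_const_def)
  qed
  moreover have "g 0 \<in> Sym V d" using g by (simp add: Sym_ps_def)
  ultimately have "D g = D (ps_const (g 0)) + D (ps_scale ?l (\<lambda>n. g (Suc n)))"
    using cont_derivation_add[OF D ps_const_in_Sym_ps l] by metis
  then show ?thesis
    using cont_derivation_scale[OF D s, of ?l] unfolding ps_scale_lambda by simp
qed

lemma cont_derivation_coeff_0:
  assumes "cont_derivation V D" "g \<in> Sym_ps V d"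
  shows "D g 0 = D (ps_const (g 0)) 0"
  by (subst cont_derivation_split[OF assms]) simp

lemma cont_derivation_coeff_1:
  assumes "cont_derivation V D" "g \<in> Sym_ps V d"
  shows "D g 1 = D (ps_const (g 0)) 1 + D (ps_const (g 1)) 0"
proof -
  have "(\<lambda>n. g (Suc n)) \<in> Sym_ps V d" using assms(2) by (simp add: Sym_ps_def)
  from cont_derivation_coeff_0[OF assms(1) this] show ?thesis
    by (subst cont_derivation_split[OF assms]) simp
qed

lemma cont_derivation_zero: "cont_derivation V D \<Longrightarrow> D 0 = 0"
proof -
  assume D: "cont_derivation V D"
  have "0 \<in> Sym_ps V 0" by (simp add: Sym_ps_def zero_in_Sym)
  from cont_derivation_add[OF D this this] show ?thesis by simp
qed

text \<open>In a \<open>glcs\<close> the seminorms are a bare set of real functions, so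
  nonnegativity is imposed here. It makes the bounds defining \<open>form_ball\<close> monotone in
  the set of seminorms and in the constant.\<close>

locale nonneg_glcs =
  fixes V :: "('k::real_normed_field, 'v::ab_group_add) glcs"
  assumes homog_total: "v \<in> homog V i \<Longrightarrow> v \<in> total V"
    and seminorm_nonneg: "p \<in> seminorms V \<Longrightarrow> v \<in> total V \<Longrightarrow> 0 \<le> p v"
begin

section \<open>Balls of forms and evaluation of completed tensors\<close>

lemma prod_seminorm_mono:
  assumes "finite Q" "P \<subseteq> Q" "Q \<subseteq> seminorms V" "set vs \<subseteq> total V"
  shows "0 \<le> prod_list (map (\<lambda>v. \<Sum>p\<in>P. p v) vs) \<and>
    prod_list (map (\<lambda>v. \<Sum>p\<in>P. p v) vs) \<le> prod_list (map (\<lambda>v. \<Sum>p\<in>Q. p v) vs)"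
  using assms(4)
proof (induct vs)
  case (Cons v vs)
  have "0 \<le> (\<Sum>p\<in>P. p v)" using Cons assms by (intro sum_nonneg seminorm_nonneg) auto
  moreover have "(\<Sum>p\<in>P. p v) \<le> (\<Sum>p\<in>Q. p v)"
    using Cons assms by (intro sum_mono2) (auto intro: seminorm_nonneg)
  ultimately show ?case using Cons by (auto intro!: mult_mono)
qed simp

lemma prod_seminorm_nonneg:
  assumes "P \<subseteq> seminorms V" "set vs \<subseteq> total V"
  shows "0 \<le> prod_list (map (\<lambda>v. \<Sum>p\<in>P. p v) vs)"
  using assms by (auto intro!: prod_list_nonneg sum_nonneg) (metis seminorm_nonneg subset_eq)

lemma form_ball_mono:
  assumes "finite Q" "P \<subseteq> Q" "Q \<subseteq> seminorms V"
  shows "form_ball V n P 1 \<subseteq> form_ball V n Q 1"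
  unfolding form_ball_def using prod_seminorm_mono[OF assms] by (auto intro: order_trans)

lemma form_ball_scale:
  assumes "\<beta> \<in> form_ball V n P C"
  shows "(\<lambda>vs. a * \<beta> vs) \<in> form_ball V n P (norm a * C)"
proof -
  have "norm (a * \<beta> vs) \<le> norm a * C * prod_list (map (\<lambda>v. \<Sum>p\<in>P. p v) vs)"
    if "length vs = n" "set vs \<subseteq> total V" for vs
  proof -
    have "norm (\<beta> vs) \<le> C * prod_list (map (\<lambda>v. \<Sum>p\<in>P. p v) vs)"
      using assms that by (simp add: form_ball_def)
    then show ?thesis
      by (simp add: norm_mult mult.assoc mult_left_mono)
  qed
  then show ?thesis using assms unfolding form_ball_def by (auto simp: algebra_simps)
qed

lemma sym_forms_scale:
  assumes "\<beta> \<in> sym_forms V n"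
  shows "(\<lambda>vs. a * \<beta> vs) \<in> sym_forms V n"
proof -
  have "(\<lambda>vs. a * \<beta> vs) \<in> cont_forms V n"
  proof -
    obtain P C where "P \<in> {P. finite P \<and> P \<subseteq> seminorms V}" "\<beta> \<in> form_ball V n P C"
      using assms unfolding sym_forms_def cont_forms_def by auto
    then show ?thesis
      unfolding cont_forms_def by (intro UN_I[of P] UN_I[of "norm a * C"] form_ball_scale) auto
  qed
  moreover have "graded_symmetric V (\<lambda>vs. a * \<beta> vs)"
    unfolding graded_symmetric_def
  proof (intro allI ballI)
    fix us ws i j x y assume "x \<in> homog V i" "y \<in> homog V j"
    then have "\<beta> (us @ [x, y] @ ws) = koszul i j * \<beta> (us @ [y, x] @ ws)"
      using assms unfolding sym_forms_def graded_symmetric_def by blast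
    then show "a * \<beta> (us @ [x, y] @ ws) = koszul i j * (a * \<beta> (us @ [y, x] @ ws))"
      by (simp only: mult.left_commute)
  qed
  ultimately show ?thesis by (simp add: sym_forms_def)
qed

lemma alg_form_scale:
  assumes "u \<in> alg_tensor_power V n d" "\<beta> \<in> sym_forms V n"
  shows "u (\<lambda>vs. a * \<beta> vs) = a * u \<beta>"
  using assms(1)
proof (induct u rule: alg_tensor_power_induct)
  case (add u b vs)
  then have "length vs = n" by (auto simp: homog_lists_def)
  with add show ?case
    using assms(2) sym_forms_scale[OF assms(2), of a]
    by (simp add: pure_tensor_def sym_forms_subset algebra_simps)
qed simp

text \<open>The projective seminorms are suprema over unit balls, so a form at which tensors are to
  be evaluated must first be rescaled into one.\<close>

lemma form_ball_norm:
  assumes "\<beta> \<in> form_ball V n P C" "P \<subseteq> seminorms V"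
  obtains K where "K > 0" "(\<lambda>vs. of_real (inverse K) * \<beta> vs) \<in> form_ball V n P 1"
proof
  \<comment> \<open>The maximum with 1 keeps the divisor positive even when \<open>C\<close> is
    not.\<close>
  define K where "K = max C 1"
  show "K > 0" by (simp add: K_def)
  have "norm (of_real (inverse K) * \<beta> vs :: 'k) \<le> prod_list (map (\<lambda>v. \<Sum>p\<in>P. p v) vs)"
    if "length vs = n" "set vs \<subseteq> total V" for vs
  proof -
    have "norm (\<beta> vs) \<le> C * prod_list (map (\<lambda>v. \<Sum>p\<in>P. p v) vs)"
      using assms that by (simp add: form_ball_def)
    also have "\<dots> \<le> K * prod_list (map (\<lambda>v. \<Sum>p\<in>P. p v) vs)"
      using prod_seminorm_nonneg[OF assms(2) that(2)] by (intro mult_right_mono) (auto simp: K_def)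
    finally show ?thesis using \<open>K > 0\<close> by (simp add: norm_mult norm_inverse norm_divide field_simps)
  qed
  then show "(\<lambda>vs. of_real (inverse K) * \<beta> vs) \<in> form_ball V n P 1"
    using form_ball_scale[OF assms(1), of "of_real (inverse K)"] unfolding form_ball_def by auto
qed

text \<open>Pure tensors are homogeneous in the form at which they are evaluated, and this passes to
  uniform limits on balls.\<close>

lemma sym_power_form_scale:
  assumes t: "t \<in> sym_power V n d" and \<beta>: "\<beta> \<in> sym_forms V n"
  shows "t (\<lambda>vs. a * \<beta> vs) = a * t \<beta>"
proof -
  obtain t' where t': "t = sym_class V n t'" "t' \<in> tensor_power V n d"
    using t by (auto simp: sym_power_def)
  obtain P C where P: "finite P" "P \<subseteq> seminorms V" and \<beta>P: "\<beta> \<in> form_ball V n P C"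
    using \<beta> unfolding sym_forms_def cont_forms_def by blast
  \<comment> \<open>A radius for which the ball contains both the form and its multiple, so that a
    single approximant serves both.\<close>
  let ?C = "max C (norm a * C)"
  have mono: "form_ball V n P C' \<subseteq> form_ball V n P ?C" if "C' \<le> ?C" for C'
  proof -
    have "C' * prod_list (map (\<lambda>v. \<Sum>p\<in>P. p v) vs) \<le> ?C * prod_list (map (\<lambda>v. \<Sum>p\<in>P. p v) vs)"
      if "set vs \<subseteq> total V" for vs
      using prod_seminorm_nonneg[OF P(2) that] \<open>C' \<le> ?C\<close> by (intro mult_right_mono)
    then show ?thesis unfolding form_ball_def by (auto intro: order_trans)
  qed
  have b1: "\<beta> \<in> form_ball V n P ?C" using \<beta>P mono[of C] by auto
  have b2: "(\<lambda>vs. a * \<beta> vs) \<in> form_ball V n P ?C"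
    using form_ball_scale[OF \<beta>P, of a] mono[of "norm a * C"] by auto
  have "norm (t' (\<lambda>vs. a * \<beta> vs) - a * t' \<beta>) \<le> e" if "e > 0" for e
  proof -
    define e' where "e' = e / (1 + norm a)"
    have a1: "1 + norm a > 0" by (rule add_pos_nonneg) auto
    then have "e' * (1 + norm a) = e" by (simp add: e'_def)
    then have e'_sum: "e' + norm a * e' = e" by (simp only: distrib_left mult_1_right mult.commute)
    have e': "e' > 0" using a1 that by (simp add: e'_def)
    obtain u where u: "u \<in> alg_tensor_power V n d" "\<forall>\<beta>\<in>form_ball V n P ?C. norm (t' \<beta> - u \<beta>) \<le> e'"
      by (rule tensor_power_approx[OF t'(2) P e'])
    have "norm (t' (\<lambda>vs. a * \<beta> vs) - a * t' \<beta>) =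
        norm ((t' (\<lambda>vs. a * \<beta> vs) - u (\<lambda>vs. a * \<beta> vs)) - a * (t' \<beta> - u \<beta>))"
      by (simp add: alg_form_scale[OF u(1) \<beta>] algebra_simps)
    also have "\<dots> \<le> norm (t' (\<lambda>vs. a * \<beta> vs) - u (\<lambda>vs. a * \<beta> vs)) + norm a * norm (t' \<beta> - u \<beta>)"
      by (metis norm_triangle_ineq4 norm_mult)
    also have "\<dots> \<le> e' + norm a * e'"
      using u(2) b1 b2 by (intro add_mono mult_left_mono) auto
    finally show ?thesis using e'_sum by simp
  qed
  then have "t' (\<lambda>vs. a * \<beta> vs) = a * t' \<beta>"
    by (metis field_le_epsilon add_0 norm_le_zero_iff right_minus_eq)
  then show ?thesis using t'(1) \<beta> sym_forms_scale[OF \<beta>, of a] by (simp add: sym_class_def)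
qed

lemma alg_bounded:
  assumes "u \<in> alg_tensor_power V n d"
  shows "\<exists>K. \<forall>\<beta>\<in>form_ball V n P 1. norm (u \<beta>) \<le> K"
  using assms
proof (induct u rule: alg_tensor_power_induct)
  case zero
  show ?case by (intro exI[of _ 0]) auto
next
  case (add u a vs)
  then obtain K where K: "\<And>\<beta>. \<beta> \<in> form_ball V n P 1 \<Longrightarrow> norm (u \<beta>) \<le> K" by blast
  have vs: "length vs = n" "set vs \<subseteq> total V"
    using add(3) homog_total by (auto simp: homog_lists_def list_all2_conv_all_nth set_conv_nth)
  let ?M = "\<bar>prod_list (map (\<lambda>v. \<Sum>p\<in>P. p v) vs)\<bar>"
  have "norm (u \<beta> + a * pure_tensor V vs \<beta>) \<le> K + norm a * ?M" if "\<beta> \<in> form_ball V n P 1" for \<beta>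
  proof -
    have "norm (\<beta> vs) \<le> ?M"
      using that vs by (force simp: form_ball_def)
    then have "norm (pure_tensor V vs \<beta>) \<le> ?M" by (auto simp: pure_tensor_def)
    then have "norm (a * pure_tensor V vs \<beta>) \<le> norm a * ?M" by (simp add: norm_mult mult_left_mono)
    then show ?thesis using K[OF that] norm_triangle_mono by blast
  qed
  then show ?case by blast
qed

text \<open>An approximant at distance 1 on the ball is a finite sum of evaluations, hence bounded
  there. This is what makes the real supremum in \<open>sym_power_seminorm\<close> an upper
  bound.\<close>

lemma sym_power_bdd_above:
  assumes "t \<in> sym_power V n d" "finite P" "P \<subseteq> seminorms V"
  shows "bdd_above ((\<lambda>\<beta>. norm (t \<beta>)) ` (form_ball V n P 1 \<inter> sym_forms V n))"
proof -
  obtain t' where t': "t = sym_class V n t'" "t' \<in> tensor_power V n d"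
    using assms by (auto simp: sym_power_def)
  have "\<exists>u\<in>alg_tensor_power V n d. \<forall>\<beta>\<in>form_ball V n P 1. norm (t' \<beta> - u \<beta>) \<le> 1"
    using t'(2) assms(2,3) unfolding tensor_power_def by simp
  then obtain u where u: "u \<in> alg_tensor_power V n d" "\<And>\<beta>. \<beta> \<in> form_ball V n P 1 \<Longrightarrow> norm (t' \<beta> - u \<beta>) \<le> 1"
    by blast
  obtain K where K: "\<And>\<beta>. \<beta> \<in> form_ball V n P 1 \<Longrightarrow> norm (u \<beta>) \<le> K"
    using alg_bounded[OF u(1)] by blast
  have "norm (t \<beta>) \<le> 1 + K" if "\<beta> \<in> form_ball V n P 1 \<inter> sym_forms V n" for \<beta>
    using u(2)[of \<beta>] K[of \<beta>] that norm_triangle_sub[of "t' \<beta>" "u \<beta>"] by (auto simp: t' sym_class_def)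
  then show ?thesis by (auto simp: bdd_above_def)
qed

lemma zero_in_unit_ball: "P \<subseteq> seminorms V \<Longrightarrow> 0 \<in> form_ball V n P 1 \<inter> sym_forms V n"
  using zero_in_sym_forms by (auto intro!: zero_in_form_ball) (metis seminorm_nonneg subset_eq)

text \<open>A seminorm of the power series algebra inspects one coefficient; on a constant series of
  a single weight it either vanishes or is a multiple of one projective seminorm.\<close>

lemma ps_seminorm_weight_part:
  assumes "q \<in> ps_seminorms V"
  shows "\<exists>P R. finite P \<and> P \<subseteq> seminorms V \<and> 0 \<le> R \<and>
    (\<forall>t e. 0 \<le> e \<and> (\<forall>\<beta>\<in>form_ball V n P 1 \<inter> sym_forms V n. norm (t \<beta>) \<le> e) \<longrightarrow>
       \<bar>q (ps_const (weight_part n t))\<bar> \<le> R * e)"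
proof -
  obtain q' k where q: "q = (\<lambda>f. q' (f k))" "q' \<in> sym_seminorms V"
    using assms by (auto simp: ps_seminorms_def)
  obtain r P where q': "q' = (\<lambda>T. \<Sum>n\<in>{n. T n \<noteq> 0}. r n * sym_power_seminorm V n (P n) (T n))"
    and rP: "\<And>n. 0 \<le> r n" "\<And>n. finite (P n)" "\<And>n. P n \<subseteq> seminorms V"
    using q(2) by (auto simp: sym_seminorms_def)
  have "\<bar>q (ps_const (weight_part n t))\<bar> \<le> r n * e"
    if e: "0 \<le> e" "\<forall>\<beta>\<in>form_ball V n (P n) 1 \<inter> sym_forms V n. norm (t \<beta>) \<le> e" for t e
  proof (cases "k = 0 \<and> t \<noteq> 0")
    \<comment> \<open>The sums in \<open>sym_seminorms\<close> run over nonzero components only, so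
      here the sum is empty.\<close>
    case False
    then have "{j. ps_const (weight_part n t) k j \<noteq> 0} = {}"
      by (auto simp: ps_const_def weight_part_def)
    then show ?thesis using e rP by (simp add: q q' del: Collect_empty_eq)
  next
    case True
    then have "{j. ps_const (weight_part n t) k j \<noteq> 0} = {n}"
      by (auto simp: ps_const_def weight_part_def)
    then have eq: "q (ps_const (weight_part n t)) = r n * sym_power_seminorm V n (P n) t"
      using True by (simp add: q q') (simp add: ps_const_def weight_part_def)
    let ?B = "form_ball V n (P n) 1 \<inter> sym_forms V n"
    \<comment> \<open>The zero form makes the supremum range over a nonempty set and bounds it below
      by 0.\<close>
    have z: "0 \<in> ?B" using zero_in_unit_ball rP by blast
    have "sym_power_seminorm V n (P n) t \<le> e"
      unfolding sym_power_seminorm_def using z e by (intro cSUP_least) auto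
    moreover have "bdd_above ((\<lambda>\<beta>. norm (t \<beta>)) ` ?B)"
      using e by (auto simp: bdd_above_def)
    then have "norm (t 0) \<le> sym_power_seminorm V n (P n) t"
      unfolding sym_power_seminorm_def using z by (rule cSUP_upper[rotated])
    then have "0 \<le> sym_power_seminorm V n (P n) t" using norm_ge_zero order_trans by blast
    ultimately show ?thesis using rP(1)[of n] by (simp add: eq abs_mult mult_left_mono)
  qed
  then show ?thesis using rP by (intro exI[of _ "P n"] exI[of _ "r n"]) blast
qed

text \<open>Continuity of \<open>D\<close>, transported to projective seminorms in a single weight;
  this estimate lets vanishing pass from algebraic tensors to the completion.\<close>

lemma derivation_eval_bound:
  assumes D: "cont_derivation V D" and \<epsilon>: "\<epsilon> \<in> sym_forms V m"
  shows "\<exists>P R. finite P \<and> P \<subseteq> seminorms V \<and>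
    (\<forall>t\<in>sym_power V n d. \<forall>e\<ge>0.
       (\<forall>\<beta>\<in>form_ball V n P 1 \<inter> sym_forms V n. norm (t \<beta>) \<le> e) \<longrightarrow>
       norm (D (ps_const (weight_part n t)) 0 m \<epsilon>) \<le> R * e)"
proof -
  obtain P0 C0 where P0: "finite P0" "P0 \<subseteq> seminorms V" and "\<epsilon> \<in> form_ball V m P0 C0"
    using \<epsilon> unfolding sym_forms_def cont_forms_def by blast
  then obtain K where K: "K > 0" "(\<lambda>vs. of_real (inverse K) * \<epsilon> vs) \<in> form_ball V m P0 1"
    using form_ball_norm by blast
  \<comment> \<open>This seminorm sees weight \<open>m\<close> only and uses the family
    \<open>P0\<close> that bounds \<open>\<epsilon>\<close>, so it dominates evaluation at
    \<open>\<epsilon>\<close> up to the factor \<open>K\<close>.\<close>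
  define q' where "q' = (\<lambda>T. \<Sum>n\<in>{n. T n \<noteq> 0}.
    (if n = m then 1 else 0) * sym_power_seminorm V n (if n = m then P0 else {}) (T n))"
  have q'_mem: "q' \<in> sym_seminorms V"
    unfolding sym_seminorms_def
  proof (intro CollectI exI conjI)
    show "q' = (\<lambda>T. \<Sum>n\<in>{n. T n \<noteq> 0}. (\<lambda>n. if n = m then 1 else 0) n *
      sym_power_seminorm V n ((\<lambda>n. if n = m then P0 else {}) n) (T n))" by (simp add: q'_def)
  qed (use P0 in auto)
  have q'_ge: "norm (T m \<epsilon>) \<le> K * q' T" if T: "T \<in> Sym V d'" for T d'
  proof (cases "T m = 0")
    case True
    then have "q' T = 0" unfolding q'_def by (intro sum.neutral) auto
    then show ?thesis using True by simp
  next
    case False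
    have fin: "finite {n. T n \<noteq> 0}" and Tm: "T m \<in> sym_power V m d'" using T by (auto simp: Sym_def)
    have "q' T = (\<Sum>n\<in>{n. T n \<noteq> 0}. if n = m then sym_power_seminorm V m P0 (T m) else 0)"
      unfolding q'_def by (intro sum.cong) auto
    also have "\<dots> = sym_power_seminorm V m P0 (T m)"
      using fin False by (simp add: sum.delta)
    finally have eq: "q' T = sym_power_seminorm V m P0 (T m)" .
    have "norm (T m (\<lambda>vs. of_real (inverse K) * \<epsilon> vs)) \<le> q' T"
      unfolding eq sym_power_seminorm_def
      using K(2) sym_forms_scale[OF \<epsilon>] by (intro cSUP_upper sym_power_bdd_above[OF Tm P0]) auto
    then have "inverse K * norm (T m \<epsilon>) \<le> q' T"
      using K(1) unfolding sym_power_form_scale[OF Tm \<epsilon>] by (simp add: norm_mult norm_inverse)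
    then show ?thesis using K(1) by (simp add: field_simps)
  qed
  have "(\<lambda>f. q' (f 0)) \<in> ps_seminorms V"
    using q'_mem unfolding ps_seminorms_def by blast
  then have "\<exists>F C. finite F \<and> F \<subseteq> ps_seminorms V \<and>
      (\<forall>f\<in>Sym_ps V d. q' (D f 0) \<le> C * (\<Sum>q\<in>F. q f))"
    using cont_derivation_cont[OF D, of d] unfolding seminorm_continuous_def by (rule bspec[rotated])
  then obtain F C where F: "finite F" "F \<subseteq> ps_seminorms V"
    and C: "\<And>f. f \<in> Sym_ps V d \<Longrightarrow> q' (D f 0) \<le> C * (\<Sum>q\<in>F. q f)"
    by auto
  have "\<forall>q\<in>F. \<exists>P R. finite P \<and> P \<subseteq> seminorms V \<and> 0 \<le> R \<and>
    (\<forall>t e. 0 \<le> e \<and> (\<forall>\<beta>\<in>form_ball V n P 1 \<inter> sym_forms V n. norm (t \<beta>) \<le> e) \<longrightarrow>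
       \<bar>q (ps_const (weight_part n t))\<bar> \<le> R * e)"
    using F(2) ps_seminorm_weight_part by blast
  then obtain P R where PR: "\<And>q. q \<in> F \<Longrightarrow> finite (P q) \<and> P q \<subseteq> seminorms V \<and> 0 \<le> R q \<and>
    (\<forall>t e. 0 \<le> e \<and> (\<forall>\<beta>\<in>form_ball V n (P q) 1 \<inter> sym_forms V n. norm (t \<beta>) \<le> e) \<longrightarrow>
       \<bar>q (ps_const (weight_part n t))\<bar> \<le> R q * e)"
    by metis
  \<comment> \<open>Enlarging the set of seminorms enlarges the unit ball, so a bound on the ball of
    \<open>?Q\<close> is a bound on the ball of every \<open>P q\<close>.\<close>
  let ?Q = "\<Union>q\<in>F. P q"
  have Q: "finite ?Q" "?Q \<subseteq> seminorms V" using F PR by (blast, blast)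
  have "norm (D (ps_const (weight_part n t)) 0 m \<epsilon>) \<le> (K * \<bar>C\<bar> * (\<Sum>q\<in>F. R q)) * e"
    if t: "t \<in> sym_power V n d" and e: "0 \<le> e"
      and te: "\<forall>\<beta>\<in>form_ball V n ?Q 1 \<inter> sym_forms V n. norm (t \<beta>) \<le> e" for t e
  proof -
    let ?f = "ps_const (weight_part n t)"
    have f: "?f \<in> Sym_ps V d" using t by (intro ps_const_in_Sym_ps weight_part_in_Sym)
    have Df: "D ?f 0 \<in> Sym V (d + 1)" using cont_derivation_mem[OF D f] by (simp add: Sym_ps_def)
    have "\<bar>q ?f\<bar> \<le> R q * e" if "q \<in> F" for q
    proof -
      have "form_ball V n (P q) 1 \<subseteq> form_ball V n ?Q 1"
        using that by (intro form_ball_mono Q) auto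
      then show ?thesis using PR[OF that] e te by blast
    qed
    then have "(\<Sum>q\<in>F. \<bar>q ?f\<bar>) \<le> (\<Sum>q\<in>F. R q * e)" by (rule sum_mono)
    then have sum: "\<bar>\<Sum>q\<in>F. q ?f\<bar> \<le> (\<Sum>q\<in>F. R q) * e"
      using sum_abs[of "\<lambda>q. q ?f" F] unfolding sum_distrib_right by (rule order_trans[rotated])
    have "q' (D ?f 0) \<le> \<bar>C * (\<Sum>q\<in>F. q ?f)\<bar>" using C[OF f] by linarith
    also have "\<dots> \<le> \<bar>C\<bar> * ((\<Sum>q\<in>F. R q) * e)"
      using sum by (simp add: abs_mult mult_left_mono)
    finally have "K * q' (D ?f 0) \<le> K * (\<bar>C\<bar> * ((\<Sum>q\<in>F. R q) * e))"
      using K(1) by (intro mult_left_mono) auto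
    then show ?thesis using q'_ge[OF Df] by (simp add: mult.assoc)
  qed
  then show ?thesis using Q by blast
qed

section \<open>Extension of vanishing from products of generators by density\<close>

lemma derivation_eval_add:
  assumes "cont_derivation V D" "T \<in> Sym V d" "S \<in> Sym V d"
  shows "D (ps_const (T + S)) 0 m \<epsilon> = D (ps_const T) 0 m \<epsilon> + D (ps_const S) 0 m \<epsilon>"
  unfolding ps_const_add
  using cont_derivation_add[OF assms(1) ps_const_in_Sym_ps ps_const_in_Sym_ps, OF assms(2,3)] by simp

lemma derivation_eval_scale:
  assumes "cont_derivation V D" "T \<in> Sym V d"
  shows "D (ps_const (sym_scale a T)) 0 m \<epsilon> = a * D (ps_const T) 0 m \<epsilon>"
  unfolding ps_const_scale
  using cont_derivation_scale[OF assms(1) ps_const_in_Sym_ps[OF assms(2)]]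
  by (metis ps_scale_const sym_scale_def)

lemma derivation_eval_alg:
  assumes D: "cont_derivation V D"
    and pure: "\<And>vs. vs \<in> homog_lists V n d \<Longrightarrow> D (ps_const (pure_sym V vs)) 0 m \<epsilon> = 0"
    and "u \<in> alg_tensor_power V n d"
  shows "D (ps_const (weight_part n (sym_class V n u))) 0 m \<epsilon> = 0"
  using assms(3)
proof (induct u rule: alg_tensor_power_induct)
  case zero
  have eq: "weight_part n (sym_class V n (\<lambda>\<beta>. 0)) = 0" by (auto simp: weight_part_def sym_class_def fun_eq_iff)
  show ?case unfolding eq ps_const_0 cont_derivation_zero[OF D] by simp
next
  case (add u a vs)
  then have "length vs = n" by (auto simp: homog_lists_def)
  then have eq: "weight_part n (sym_class V n (\<lambda>\<beta>. u \<beta> + a * pure_tensor V vs \<beta>)) =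
      weight_part n (sym_class V n u) + sym_scale a (pure_sym V vs)"
    by (auto simp: weight_part_def sym_class_def pure_sym_def sym_scale_def fun_eq_iff)
  have u: "weight_part n (sym_class V n u) \<in> Sym V d"
    using add(1) by (intro weight_part_in_Sym) (simp add: sym_power_def alg_in_tensor_power)
  have p: "pure_sym V vs \<in> Sym V d" using add(3) by (rule pure_sym_in_Sym)
  show ?case
    unfolding eq derivation_eval_add[OF D u Sym_scale[OF p]] derivation_eval_scale[OF D p] pure[OF add(3)] add(2)
    by simp
qed

text \<open>Products of homogeneous generators span a dense subspace.\<close>

lemma derivation_eval_eq_0:
  assumes D: "cont_derivation V D" and \<epsilon>: "\<epsilon> \<in> sym_forms V m"
    and pure: "\<And>n vs. vs \<in> homog_lists V n d \<Longrightarrow> D (ps_const (pure_sym V vs)) 0 m \<epsilon> = 0"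
    and S: "S \<in> Sym V d"
  shows "D (ps_const S) 0 m \<epsilon> = 0"
proof -
  have single: "D (ps_const (weight_part n t)) 0 m \<epsilon> = 0" if t: "t \<in> sym_power V n d" for n t
  proof -
    obtain t' where t': "t = sym_class V n t'" "t' \<in> tensor_power V n d"
      using t by (auto simp: sym_power_def)
    obtain P R where PR: "finite P \<and> P \<subseteq> seminorms V \<and>
      (\<forall>w\<in>sym_power V n d. \<forall>e\<ge>0.
         (\<forall>\<beta>\<in>form_ball V n P 1 \<inter> sym_forms V n. norm (w \<beta>) \<le> e) \<longrightarrow>
         norm (D (ps_const (weight_part n w)) 0 m \<epsilon>) \<le> R * e)"
      using derivation_eval_bound[OF D \<epsilon>, of n d] by (elim exE) (rule that)
    note P = PR[THEN conjunct1] PR[THEN conjunct2, THEN conjunct1]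
      and bound = PR[THEN conjunct2, THEN conjunct2]
    have "norm (D (ps_const (weight_part n t)) 0 m \<epsilon>) \<le> R * e" if "e > 0" for e
    proof -
      obtain u where u: "u \<in> alg_tensor_power V n d" "\<forall>\<beta>\<in>form_ball V n P 1. norm (t' \<beta> - u \<beta>) \<le> e"
        by (rule tensor_power_approx[OF t'(2) P \<open>e > 0\<close>])
      define v where "v = sym_class V n u"
      \<comment> \<open>The remainder is at most \<open>e\<close> on the ball, and \<open>D\<close>
        followed by evaluation kills \<open>v\<close>, so the value at \<open>t\<close> equals the
        small value at \<open>w\<close>.\<close>
      define w where "w = (\<lambda>\<beta>. t \<beta> + (-1) * v \<beta>)"
      have v: "v \<in> sym_power V n d" using u by (simp add: v_def sym_power_def alg_in_tensor_power)
      have w: "w \<in> sym_power V n d" unfolding w_def by (rule sym_power_add_scale[OF t v])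
      have "norm (w \<beta>) \<le> e" if "\<beta> \<in> form_ball V n P 1 \<inter> sym_forms V n" for \<beta>
        using that u(2) by (auto simp: w_def v_def t' sym_class_def)
      then have "norm (D (ps_const (weight_part n w)) 0 m \<epsilon>) \<le> R * e"
        using bound[THEN bspec, OF w] \<open>e > 0\<close> by simp
      moreover have eq: "weight_part n t = weight_part n v + weight_part n w"
        by (auto simp: weight_part_def w_def fun_eq_iff)
      have "D (ps_const (weight_part n v)) 0 m \<epsilon> = 0"
        unfolding v_def by (rule derivation_eval_alg[OF D pure u(1)])
      then have "D (ps_const (weight_part n t)) 0 m \<epsilon> = D (ps_const (weight_part n w)) 0 m \<epsilon>"
        unfolding eq derivation_eval_add[OF D weight_part_in_Sym[OF v] weight_part_in_Sym[OF w]] by simp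
      ultimately show ?thesis by (simp only:)
    qed
    note small = this
    show ?thesis
    proof (rule ccontr)
      assume "D (ps_const (weight_part n t)) 0 m \<epsilon> \<noteq> 0"
      then have pos: "norm (D (ps_const (weight_part n t)) 0 m \<epsilon>) > 0" (is "?x > 0") by simp
      \<comment> \<open>This choice of \<open>e\<close> makes the bound at most half of the quantity
        that it bounds.\<close>
      have "?x \<le> R * (?x / (2 * (1 + \<bar>R\<bar>)))" using pos by (intro small) auto
      also have "\<dots> \<le> (1 + \<bar>R\<bar>) * (?x / (2 * (1 + \<bar>R\<bar>)))" using pos by (intro mult_right_mono) auto
      also have "\<dots> = ?x / 2" by (simp add: field_simps add_eq_0_iff)
      finally show False using pos by simp
    qed
  qed
  \<comment> \<open>A general element is the finite sum of its weight components, added here one at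
    a time.\<close>
  have "(\<lambda>n. if n \<in> A then S n else 0) \<in> Sym V d \<and>
      D (ps_const (\<lambda>n. if n \<in> A then S n else 0)) 0 m \<epsilon> = 0" if "finite A" for A
    using that
  proof (induct A)
    case empty
    have eq: "(\<lambda>n. if n \<in> {} then S n else 0) = 0" by auto
    show ?case unfolding eq ps_const_0 cont_derivation_zero[OF D] by (simp add: zero_in_Sym)
  next
    case (insert k A)
    have eq: "(\<lambda>n. if n \<in> insert k A then S n else 0) = (\<lambda>n. if n \<in> A then S n else 0) + weight_part k (S k)"
      using insert(2) by (auto simp: weight_part_def fun_eq_iff)
    have k: "S k \<in> sym_power V k d" using S by (simp add: Sym_def)
    show ?case
      unfolding eq using insert(3)
      by (auto simp only: derivation_eval_add[OF D _ weight_part_in_Sym[OF k]] single[OF k] add_0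
          intro: Sym_add weight_part_in_Sym[OF k])
  qed
  from this[of "{n. S n \<noteq> 0}"] have
    "D (ps_const (\<lambda>n. if n \<in> {n. S n \<noteq> 0} then S n else 0)) 0 m \<epsilon> = 0" using S by (simp add: Sym_def)
  moreover have "(\<lambda>n. if n \<in> {n. S n \<noteq> 0} then S n else 0) = S" by auto
  ultimately show ?thesis by (simp only:)
qed

end


section \<open>Products of generators\<close>

lemma sym_scale_eval: "sym_scale a T n \<beta> = a * T n \<beta>"
  by (simp add: sym_scale_def)

text \<open>A generator lives in weight 1 only, so a single summand of the product survives, and
  none if \<open>n = 0\<close>.\<close>

lemma sym_mult_gen:
  "sym_mult V (sym_gen V v) T n \<beta> = (if \<beta> \<in> sym_forms V n \<and> n \<noteq> 0
     then sym_gen V v 1 (\<lambda>xs. T (n - 1) (\<lambda>ws. \<beta> (xs @ ws))) else 0)"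
proof -
  have "(\<Sum>i\<le>n. sym_gen V v i (\<lambda>xs. T (n - i) (\<lambda>ws. \<beta> (xs @ ws)))) =
      (\<Sum>i\<le>n. if i = 1 then sym_gen V v 1 (\<lambda>xs. T (n - 1) (\<lambda>ws. \<beta> (xs @ ws))) else 0)"
    by (intro sum.cong) (auto simp: sym_gen_def)
  then show ?thesis by (auto simp: sym_mult_def)
qed

lemma sym_gen_eval_zero: "sym_gen V v n (\<lambda>xs. 0) = 0"
  using pure_sym_eval_zero[of V "[v]" n] by (simp add: sym_gen_eq_pure_sym zero_fun_def)

lemma sym_mult_gen_weight:
  assumes "m \<noteq> 0 \<Longrightarrow> T (m - 1) = 0"
  shows "sym_mult V (sym_gen V v) T m = 0"
proof
  fix \<beta>
  show "sym_mult V (sym_gen V v) T m \<beta> = 0 \<beta>"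
    using assms unfolding sym_mult_gen by (auto simp: sym_gen_eval_zero)
qed

text \<open>The second alternative is the default value off the continuous graded symmetric
  forms.\<close>

lemma sym_gen_eval_cases: "sym_gen V v 1 \<beta> = \<beta> [v] \<or> sym_gen V v 1 \<beta> = 0"
  by (auto simp: sym_gen_def sym_class_def pure_tensor_def)

text \<open>Each generator either evaluates its argument or returns the default 0, and every
  combination of these alternatives gives 0.\<close>

lemma sym_mult_gen_gen_zero:
  assumes "\<epsilon> [a, b] = 0"
  shows "sym_mult V (sym_gen V a) (sym_gen V b) 2 \<epsilon> = 0"
proof -
  have "sym_gen V b 1 (\<lambda>ws. \<epsilon> ([a] @ ws)) = 0"
    using sym_gen_eval_cases[of V b "\<lambda>ws. \<epsilon> ([a] @ ws)"] assms by auto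
  then show ?thesis
    using sym_gen_eval_cases[of V a "\<lambda>xs. sym_gen V b 1 (\<lambda>ws. \<epsilon> (xs @ ws))"]
    by (auto simp: sym_mult_gen)
qed

lemma form_outside: "\<beta> \<in> cont_forms V n \<Longrightarrow> length vs \<noteq> n \<or> \<not> set vs \<subseteq> total V \<Longrightarrow> \<beta> vs = 0"
  by (auto simp: cont_forms_def form_ball_def)

lemma form_ball_bound:
  "\<beta> \<in> form_ball V n P C \<Longrightarrow> length vs = n \<Longrightarrow> set vs \<subseteq> total V \<Longrightarrow>
    norm (\<beta> vs) \<le> C * prod_list (map (\<lambda>v. \<Sum>p\<in>P. p v) vs)"
  by (simp add: form_ball_def)

text \<open>The seminorm of the fixed argument is absorbed into the constant of the ball. In
  \<open>sym_mult\<close> the inner factor is evaluated at such partial forms, and only continuous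
  symmetric ones avoid the default value.\<close>

lemma sym_forms_Cons:
  assumes \<beta>: "\<beta> \<in> sym_forms V (Suc n)" and x: "x \<in> total V"
  shows "(\<lambda>ws. \<beta> (x # ws)) \<in> sym_forms V n"
proof -
  obtain P C where P: "P \<in> {P. finite P \<and> P \<subseteq> seminorms V}" and b: "\<beta> \<in> form_ball V (Suc n) P C"
    using \<beta> unfolding sym_forms_def cont_forms_def by auto
  have "(\<lambda>ws. \<beta> (x # ws)) \<in> form_ball V n P (C * (\<Sum>p\<in>P. p x))"
    unfolding form_ball_def
  proof (intro CollectI conjI allI impI ballI)
    fix vs assume "length vs \<noteq> n \<or> \<not> set vs \<subseteq> total V"
    then show "\<beta> (x # vs) = 0" using b x by (auto simp: form_ball_def)
  next
    fix us ws v w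
    assume "length us + 1 + length ws = n \<and> set us \<subseteq> total V \<and> set ws \<subseteq> total V"
      and "v \<in> total V" "w \<in> total V"
    then have "\<beta> ((x # us) @ [v + w] @ ws) = \<beta> ((x # us) @ [v] @ ws) + \<beta> ((x # us) @ [w] @ ws)"
      using b x unfolding form_ball_def by (elim CollectE conjE) (simp del: append_Cons)
    then show "\<beta> (x # us @ [v + w] @ ws) = \<beta> (x # us @ [v] @ ws) + \<beta> (x # us @ [w] @ ws)" by simp
  next
    fix us ws v a
    assume "length us + 1 + length ws = n \<and> set us \<subseteq> total V \<and> set ws \<subseteq> total V"
      and "v \<in> total V"
    then have "\<beta> ((x # us) @ [scl V a v] @ ws) = a * \<beta> ((x # us) @ [v] @ ws)"
      using b x unfolding form_ball_def by (elim CollectE conjE) (simp del: append_Cons)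
    then show "\<beta> (x # us @ [scl V a v] @ ws) = a * \<beta> (x # us @ [v] @ ws)" by simp
  next
    fix vs assume "length vs = n \<and> set vs \<subseteq> total V"
    then have "norm (\<beta> (x # vs)) \<le> C * prod_list (map (\<lambda>v. \<Sum>p\<in>P. p v) (x # vs))"
      using x by (intro form_ball_bound[OF b]) auto
    then show "norm (\<beta> (x # vs)) \<le> C * (\<Sum>p\<in>P. p x) * prod_list (map (\<lambda>v. \<Sum>p\<in>P. p v) vs)"
      by (simp add: mult.assoc)
  qed
  then have "(\<lambda>ws. \<beta> (x # ws)) \<in> cont_forms V n"
    unfolding cont_forms_def using P by (intro UN_I[of P] UN_I[of "C * (\<Sum>p\<in>P. p x)"]) auto
  moreover have "graded_symmetric V (\<lambda>ws. \<beta> (x # ws))"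
    unfolding graded_symmetric_def
  proof (intro allI ballI)
    fix us ws i j v w assume "v \<in> homog V i" "w \<in> homog V j"
    then have "\<beta> ((x # us) @ [v, w] @ ws) = koszul i j * \<beta> ((x # us) @ [w, v] @ ws)"
      using \<beta> unfolding sym_forms_def graded_symmetric_def by blast
    then show "\<beta> (x # us @ [v, w] @ ws) = koszul i j * \<beta> (x # us @ [w, v] @ ws)" by simp
  qed
  ultimately show ?thesis by (simp add: sym_forms_def)
qed

text \<open>Now the trailing arguments are fixed, for the outer factor of \<open>sym_mult\<close>.
  The guard on the length makes graded symmetry trivial, since a transposition needs at least two
  arguments.\<close>

lemma sym_forms_contract:
  assumes \<beta>: "\<beta> \<in> sym_forms V (Suc n)" and vs: "length vs = n" "set vs \<subseteq> total V"
  shows "(\<lambda>xs. if length xs = 1 then \<beta> (xs @ vs) else 0) \<in> sym_forms V 1"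
proof -
  obtain P C where P: "P \<in> {P. finite P \<and> P \<subseteq> seminorms V}" and b: "\<beta> \<in> form_ball V (Suc n) P C"
    using \<beta> unfolding sym_forms_def cont_forms_def by auto
  let ?\<gamma> = "\<lambda>xs. if length xs = 1 then \<beta> (xs @ vs) else 0"
  let ?C = "C * prod_list (map (\<lambda>v. \<Sum>p\<in>P. p v) vs)"
  have "?\<gamma> \<in> form_ball V 1 P ?C"
    unfolding form_ball_def
  proof (intro CollectI conjI allI impI ballI)
    fix xs assume "length xs \<noteq> 1 \<or> \<not> set xs \<subseteq> total V"
    then show "?\<gamma> xs = 0"
      using b by (auto simp: form_ball_def)
  next
    fix us ws v w
    assume *: "length us + 1 + length ws = 1 \<and> set us \<subseteq> total V \<and> set ws \<subseteq> total V"
      "v \<in> total V" "w \<in> total V"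
    then have "\<beta> ([] @ [v + w] @ vs) = \<beta> ([] @ [v] @ vs) + \<beta> ([] @ [w] @ vs)"
      using b vs unfolding form_ball_def
      by (elim CollectE conjE) (simp del: append_Cons append_Nil)
    then show "?\<gamma> (us @ [v + w] @ ws) = ?\<gamma> (us @ [v] @ ws) + ?\<gamma> (us @ [w] @ ws)" using * by simp
  next
    fix us ws v a
    assume *: "length us + 1 + length ws = 1 \<and> set us \<subseteq> total V \<and> set ws \<subseteq> total V"
      "v \<in> total V"
    then have "\<beta> ([] @ [scl V a v] @ vs) = a * \<beta> ([] @ [v] @ vs)"
      using b vs unfolding form_ball_def
      by (elim CollectE conjE) (simp del: append_Cons append_Nil)
    then show "?\<gamma> (us @ [scl V a v] @ ws) = a * ?\<gamma> (us @ [v] @ ws)" using * by simp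
  next
    fix xs assume *: "length xs = 1 \<and> set xs \<subseteq> total V"
    then have "norm (\<beta> (xs @ vs)) \<le> C * prod_list (map (\<lambda>v. \<Sum>p\<in>P. p v) (xs @ vs))"
      using vs by (intro form_ball_bound[OF b]) auto
    then show "norm (?\<gamma> xs) \<le> ?C * prod_list (map (\<lambda>v. \<Sum>p\<in>P. p v) xs)"
      using * by (simp add: mult_ac)
  qed
  then have "?\<gamma> \<in> cont_forms V 1"
    unfolding cont_forms_def using P by (intro UN_I[of P] UN_I[of ?C]) auto
  then show ?thesis
    by (simp add: sym_forms_def graded_symmetric_def)
qed

text \<open>Iterated, this exhibits pure tensors of homogeneous vectors as products of generators,
  which brings them within reach of the Leibniz rule.\<close>

lemma sym_mult_gen_pure:
  assumes v: "v \<in> total V" and vs: "set vs \<subseteq> total V"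
  shows "sym_mult V (sym_gen V v) (pure_sym V vs) = pure_sym V (v # vs)"
proof (intro ext)
  fix n \<beta>
  consider "\<beta> \<notin> sym_forms V n" | "\<beta> \<in> sym_forms V n" "n \<noteq> Suc (length vs)"
    | "\<beta> \<in> sym_forms V n" "n = Suc (length vs)" by blast
  then show "sym_mult V (sym_gen V v) (pure_sym V vs) n \<beta> = pure_sym V (v # vs) n \<beta>"
  proof cases
    case 1
    then show ?thesis by (auto simp: sym_mult_gen pure_sym_def sym_class_def)
  next
    case 2
    then have "sym_mult V (sym_gen V v) (pure_sym V vs) n = 0"
      by (intro sym_mult_gen_weight) (auto simp: pure_sym_def)
    then show ?thesis using 2 by (simp add: pure_sym_def)
  next
    case 3
    let ?k = "length vs"
    have \<beta>: "\<beta> \<in> sym_forms V (Suc ?k)" using 3 by simp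
    have "pure_sym V vs ?k (\<lambda>ws. \<beta> (xs @ ws)) = (if length xs = 1 then \<beta> (xs @ vs) else 0)" for xs
    proof (cases "length xs = 1 \<and> set xs \<subseteq> total V")
      case True
      then obtain x where "xs = [x]" "x \<in> total V" by (auto simp: length_Suc_conv)
      then show ?thesis using pure_sym_eval[OF sym_forms_Cons[OF \<beta>, of x]] by simp
    next
      case False
      then have "\<beta> (xs @ vs) = 0"
        using form_outside[OF sym_forms_subset[OF \<beta>], of "xs @ vs"] by auto
      then show ?thesis by (auto simp: pure_sym_def sym_class_def pure_tensor_def)
    qed
    then have eq: "(\<lambda>xs. pure_sym V vs ?k (\<lambda>ws. \<beta> (xs @ ws))) =
        (\<lambda>xs. if length xs = 1 then \<beta> (xs @ vs) else 0)" by blast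
    have "sym_mult V (sym_gen V v) (pure_sym V vs) n \<beta> =
        pure_sym V [v] (length [v]) (\<lambda>xs. if length xs = 1 then \<beta> (xs @ vs) else 0)"
      using 3 by (simp add: sym_mult_gen eq) (simp add: sym_gen_eq_pure_sym)
    also have "\<dots> = \<beta> (v # vs)"
      by (subst pure_sym_eval) (use sym_forms_contract[OF \<beta> _ vs] in auto)
    also have "\<dots> = pure_sym V (v # vs) n \<beta>"
      using pure_sym_eval[of \<beta> V "v # vs"] 3 by simp
    finally show ?thesis .
  qed
qed

lemma ps_mult_coeff_0: "ps_mult V f g 0 = sym_mult V (f 0) (g 0)"
  by (simp add: ps_mult_def)

lemma ps_mult_const:
  "ps_mult V (ps_const (sym_gen V v)) (ps_const T) = ps_const (sym_mult V (sym_gen V v) T)"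
proof
  fix n
  have 0: "sym_mult V 0 S = 0" for S by (auto simp: sym_mult_def fun_eq_iff)
  have g: "sym_mult V (sym_gen V v) 0 = 0" by (rule ext, rule trans[OF sym_mult_gen_weight]) simp_all
  have "ps_mult V (ps_const (sym_gen V v)) (ps_const T) n =
      (\<Sum>i\<le>n. if i = 0 then sym_mult V (sym_gen V v) (ps_const T n) else 0)"
    unfolding ps_mult_def by (intro sum.cong) (auto simp: ps_const_def 0)
  then show "ps_mult V (ps_const (sym_gen V v)) (ps_const T) n = ps_const (sym_mult V (sym_gen V v) T) n"
    by (auto simp: ps_const_def g)
qed

context nonneg_glcs
begin

lemma homog_list_total: "list_all2 (\<lambda>v i. v \<in> homog V i) vs ds \<Longrightarrow> set vs \<subseteq> total V"
  using homog_total by (force simp: list_all2_conv_all_nth set_conv_nth)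

lemma pure_sym_homog_mem:
  "list_all2 (\<lambda>v i. v \<in> homog V i) vs ds \<Longrightarrow> pure_sym V vs \<in> Sym V (sum_list ds)"
  by (rule pure_sym_in_Sym[of _ _ "length vs"]) (auto simp: homog_lists_def)

lemma sym_gen_mem: "v \<in> homog V k \<Longrightarrow> sym_gen V v \<in> Sym V k"
  using pure_sym_homog_mem[of "[v]" "[k]"] by (simp add: sym_gen_eq_pure_sym)

section \<open>The Leibniz rule on products of generators\<close>

lemma derivation_pure_Cons:
  assumes D: "cont_derivation V D" and v: "v \<in> homog V k"
    and vs: "list_all2 (\<lambda>v i. v \<in> homog V i) vs ds"
  shows "D (ps_const (pure_sym V (v # vs))) 0 =
    sym_mult V (D (ps_const (sym_gen V v)) 0) (pure_sym V vs) +
    sym_scale (koszul 1 k) (sym_mult V (sym_gen V v) (D (ps_const (pure_sym V vs)) 0))"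
proof -
  have "ps_const (pure_sym V (v # vs)) = ps_mult V (ps_const (sym_gen V v)) (ps_const (pure_sym V vs))"
    using v vs by (simp only: ps_mult_const sym_mult_gen_pure homog_total homog_list_total)
  moreover have "ps_const (sym_gen V v) \<in> Sym_ps V k"
    using v by (intro ps_const_in_Sym_ps sym_gen_mem)
  moreover have "ps_const (pure_sym V vs) \<in> Sym_ps V (sum_list ds)"
    using vs by (intro ps_const_in_Sym_ps pure_sym_homog_mem)
  ultimately have "D (ps_const (pure_sym V (v # vs))) =
      ps_mult V (D (ps_const (sym_gen V v))) (ps_const (pure_sym V vs)) +
      ps_scale (\<lambda>n. if n = 0 then koszul 1 k else 0)
        (ps_mult V (ps_const (sym_gen V v)) (D (ps_const (pure_sym V vs))))"
    using cont_derivation_mult[OF D] by metis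
  then show ?thesis
    by (simp add: ps_scale_const ps_mult_coeff_0) (simp add: ps_const_def)
qed

text \<open>Every term of the iterated Leibniz rule replaces one generator by one generator, so the
  number of factors is preserved.\<close>

lemma derivation_weight:
  assumes D: "cont_derivation V D"
    and gen: "\<And>k v. v \<in> homog V k \<Longrightarrow> \<exists>w. D (ps_const (sym_gen V v)) 0 = sym_gen V w"
    and "vs \<noteq> []" "list_all2 (\<lambda>v i. v \<in> homog V i) vs ds" "m \<noteq> length vs"
  shows "D (ps_const (pure_sym V vs)) 0 m = 0"
  using assms(3-)
proof (induct vs arbitrary: ds m)
  case (Cons v vs)
  then obtain k ds' where v: "v \<in> homog V k" and vs: "list_all2 (\<lambda>v i. v \<in> homog V i) vs ds'"
    by (auto simp: list_all2_Cons1)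
  obtain w where w: "D (ps_const (sym_gen V v)) 0 = sym_gen V w" using gen[OF v] by blast
  show ?case
  proof (cases "vs = []")
    case True
    then show ?thesis
      using Cons w by (simp add: sym_gen_eq_pure_sym[of V v, symmetric]) (simp add: sym_gen_def zero_fun_def)
  next
    case False
    have 1: "sym_mult V (sym_gen V w) (pure_sym V vs) m = 0"
      using Cons by (intro sym_mult_gen_weight) (auto simp: pure_sym_def)
    have "D (ps_const (pure_sym V vs)) 0 (m - 1) = 0" if "m \<noteq> 0"
      using Cons(4) that by (intro Cons(1)[OF False vs]) auto
    then have 2: "sym_mult V (sym_gen V v) (D (ps_const (pure_sym V vs)) 0) m = 0"
      by (intro sym_mult_gen_weight)
    show ?thesis
      unfolding derivation_pure_Cons[OF D v vs] w plus_fun_apply 1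
      by (rule ext) (simp add: sym_scale_eval 2)
  qed
qed simp

text \<open>By weight only products \<open>a b\<close> of two generators contribute. Their Leibniz
  terms contain the image of \<open>a\<close> or of \<open>b\<close>, and \<open>\<epsilon>\<close>
  vanishes on every pair with such an entry.\<close>

lemma derivation_eval_weight_2:
  assumes D: "cont_derivation V D" and \<epsilon>: "\<epsilon> \<in> sym_forms V 2"
    and gen: "\<And>k v. v \<in> homog V k \<Longrightarrow> \<exists>w. D (ps_const (sym_gen V v)) 0 = sym_gen V w \<and>
      (\<forall>u. \<epsilon> [w, u] = 0 \<and> \<epsilon> [u, w] = 0)"
    and S: "S \<in> Sym V 1"
  shows "D (ps_const S) 0 2 \<epsilon> = 0"
proof (rule derivation_eval_eq_0[OF D \<epsilon> _ S])
  fix n vs assume "vs \<in> homog_lists V n 1"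
  then obtain ds where n: "length vs = n" and vs: "list_all2 (\<lambda>v i. v \<in> homog V i) vs ds"
    and ds: "sum_list ds = 1" by (auto simp: homog_lists_def)
  \<comment> \<open>Weight 0 only occurs in degree 0.\<close>
  have ne: "vs \<noteq> []" using vs ds by auto
  show "D (ps_const (pure_sym V vs)) 0 2 \<epsilon> = 0"
  proof (cases "n = 2")
    case False
    then have "D (ps_const (pure_sym V vs)) 0 2 = 0"
      using gen n by (intro derivation_weight[OF D _ ne vs]) (blast, simp)
    then show ?thesis by simp
  next
    case True
    then obtain a b where ab: "vs = [a, b]" using n by (auto simp: length_Suc_conv numeral_2_eq_2)
    obtain i j where ij: "a \<in> homog V i" "b \<in> homog V j"
      using vs ab by (auto simp: list_all2_Cons1)
    obtain a' where a': "D (ps_const (sym_gen V a)) 0 = sym_gen V a'" "\<And>u. \<epsilon> [a', u] = 0"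
      using gen[OF ij(1)] by blast
    obtain b' where b': "D (ps_const (sym_gen V b)) 0 = sym_gen V b'" "\<And>u. \<epsilon> [u, b'] = 0"
      using gen[OF ij(2)] by blast
    have "list_all2 (\<lambda>v i. v \<in> homog V i) [b] [j]" using ij by simp
    from derivation_pure_Cons[OF D ij(1) this] show ?thesis
      by (simp add: ab sym_gen_eq_pure_sym[symmetric] a'(1) b'(1) sym_scale_eval
          sym_mult_gen_gen_zero a'(2) b'(2))
  qed
qed

text \<open>Compare coefficients of \<lambda> in the intertwining relation on a closed generator.
  Apart from the first order of \<open>\<delta>\<close> on it, there remain \<open>\<delta>0\<close>
  and the order zero part of \<open>\<delta>\<close> on its image under \<open>K 1\<close>; both
  vanish at \<open>\<epsilon>\<close> by the preceding lemma.\<close>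

lemma moller_first_order:
  assumes \<delta>0: "cont_derivation V \<delta>0" and \<delta>: "cont_derivation V \<delta>"
    and K: "moller_map V \<delta>0 \<delta> K"
    and v: "v \<in> homog V 1" and closed: "\<delta>0 (ps_const (sym_gen V v)) = 0"
    and \<epsilon>: "\<epsilon> \<in> sym_forms V 2"
    and gen0: "\<And>k v. v \<in> homog V k \<Longrightarrow> \<exists>w. \<delta>0 (ps_const (sym_gen V v)) 0 = sym_gen V w \<and>
      (\<forall>u. \<epsilon> [w, u] = 0 \<and> \<epsilon> [u, w] = 0)"
    and gen: "\<And>k v. v \<in> homog V k \<Longrightarrow> \<exists>w. \<delta> (ps_const (sym_gen V v)) 0 = sym_gen V w \<and>
      (\<forall>u. \<epsilon> [w, u] = 0 \<and> \<epsilon> [u, w] = 0)"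
  shows "\<delta> (ps_const (sym_gen V v)) 1 2 \<epsilon> = 0"
proof -
  let ?G = "sym_gen V v"
  let ?g = "ps_operator K (ps_const ?G)"
  have G: "?G \<in> Sym V 1" by (rule sym_gen_mem[OF v])
  have K_mem: "K n T \<in> Sym V d" if "T \<in> Sym V d" for n T d
    using K that unfolding moller_map_def by blast
  have "K n (sym_scale 0 0) = sym_scale 0 (K n 0)" for n
    using K zero_in_Sym[of V 0] unfolding moller_map_def by blast
  then have K_0: "K n 0 = 0" for n by simp
  have K0: "K 0 ?G = ?G" using K G unfolding moller_map_def by blast
  have g: "?g n = K n ?G" for n
  proof -
    have "?g n = (\<Sum>i\<le>n. if i = n then K n ?G else 0)"
      unfolding ps_operator_def by (intro sum.cong) (auto simp: ps_const_def K_0)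
    then show ?thesis by simp
  qed
  have g_mem: "?g \<in> Sym_ps V 1" using K_mem[OF G] by (simp add: Sym_ps_def g)
  have "ps_operator K 0 = \<delta>0 ?g + \<delta> ?g"
    using K ps_const_in_Sym_ps[OF G] closed unfolding moller_map_def by metis
  moreover have "ps_operator K 0 = 0" by (auto simp: ps_operator_def K_0)
  ultimately have "\<delta>0 ?g 1 + \<delta> ?g 1 = 0" by (metis plus_fun_apply zero_fun_apply)
  then have "\<delta>0 ?g 1 2 \<epsilon> + \<delta> ?g 1 2 \<epsilon> = 0" by (metis plus_fun_apply zero_fun_apply)
  \<comment> \<open>The contribution of the constant term of \<open>?g\<close>, which is
    \<open>?G\<close> itself, is zero by closedness; only the \<open>K 1\<close> term needs
    density.\<close>
  moreover have "\<delta>0 ?g 1 2 \<epsilon> = 0"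
    using derivation_eval_weight_2[OF \<delta>0 \<epsilon> gen0 K_mem[OF G]]
    unfolding cont_derivation_coeff_1[OF \<delta>0 g_mem] g K0 closed by simp
  moreover have "\<delta> ?g 1 2 \<epsilon> = \<delta> (ps_const ?G) 1 2 \<epsilon>"
    using derivation_eval_weight_2[OF \<delta> \<epsilon> gen K_mem[OF G]]
    unfolding cont_derivation_coeff_1[OF \<delta> g_mem] g K0 by simp
  ultimately show ?thesis by simp
qed

end


section \<open>Finite dimensional normed spaces\<close>

text \<open>A vector outside a closed subspace has positive distance \<open>r\<close> from it, which
  makes its coefficient Lipschitz with constant \<open>1 / r\<close>. Along a convergent sequence
  these coefficients are then Cauchy, and the limit splits accordingly.\<close>

lemma closed_span_finite:
  fixes B :: "'a::real_normed_vector set"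
  assumes "finite B"
  shows "closed (span B)"
  using assms
proof (induct B)
  case (insert b B)
  show ?case
  proof (cases "b \<in> span B")
    case True
    then show ?thesis using insert by (simp add: span_redundant)
  next
    case False
    then obtain r where r: "r > 0" "ball b r \<inter> span B = {}"
    proof -
      have "open (- span B)" "b \<in> - span B" using insert(3) False by auto
      then obtain r where "r > 0" "ball b r \<subseteq> - span B" by (rule openE)
      then show ?thesis using that[of r] by blast
    qed
    have coeff: "\<bar>k\<bar> * r \<le> norm (k *\<^sub>R b + w)" if w: "w \<in> span B" for k w
    proof (cases "k = 0")
      case False
      have "- (inverse k *\<^sub>R w) \<in> span B" using w by (intro span_neg span_scale)
      then have "r \<le> dist b (- (inverse k *\<^sub>R w))" using r(2) by (force simp: not_less)
      also have "\<dots> = norm (inverse k *\<^sub>R (k *\<^sub>R b + w))"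
        using False by (simp add: dist_norm scaleR_right_distrib)
      also have "\<dots> = norm (k *\<^sub>R b + w) / \<bar>k\<bar>" by (simp add: divide_inverse)
      finally show ?thesis using False by (simp add: field_simps)
    qed simp
    show ?thesis
      unfolding closed_sequential_limits
    proof (intro allI impI, elim conjE)
      fix x l assume x: "\<forall>n. x n \<in> span (insert b B)" and l: "x \<longlonglongrightarrow> l"
      then have "\<forall>n. \<exists>k. x n - k *\<^sub>R b \<in> span B" by (simp add: span_insert)
      then obtain k where k: "\<And>n. x n - k n *\<^sub>R b \<in> span B" by metis
      have "\<bar>k m - k n\<bar> * r \<le> dist (x m) (x n)" for m n
        using coeff[OF span_diff[OF k k], of "k m - k n" m n]
        by (simp add: dist_norm algebra_simps)
      then have diff: "dist (k m) (k n) \<le> dist (x m) (x n) / r" for m n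
        using r(1) by (simp add: dist_real_def field_simps)
      have "Cauchy x" using l LIMSEQ_imp_Cauchy by blast
      have "Cauchy k"
        unfolding Cauchy_def
      proof (intro allI impI)
        fix e :: real assume "e > 0"
        then obtain N where N: "\<forall>m\<ge>N. \<forall>n\<ge>N. dist (x m) (x n) < e * r"
          using \<open>Cauchy x\<close> r(1) unfolding Cauchy_def by (meson mult_pos_pos)
        have "dist (k m) (k n) < e" if "m \<ge> N" "n \<ge> N" for m n
          using diff[of m n] N that r(1) by (smt (verit) divide_less_eq)
        then show "\<exists>N. \<forall>m\<ge>N. \<forall>n\<ge>N. dist (k m) (k n) < e" by blast
      qed
      then obtain c where c: "k \<longlonglongrightarrow> c" using Cauchy_convergent convergent_def by blast
      have "(\<lambda>n. x n - k n *\<^sub>R b) \<longlonglongrightarrow> l - c *\<^sub>R b"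
        by (intro tendsto_intros l c)
      then have "l - c *\<^sub>R b \<in> span B"
        by (rule closed_sequentially[OF insert(3) k])
      then show "l \<in> span (insert b B)" by (auto simp: span_insert)
    qed
  qed
qed simp

text \<open>The kernel is again a finite span, hence closed, and a functional with closed kernel is
  bounded.\<close>

lemma bounded_linear_functional_finite_dim:
  fixes f :: "'a::real_normed_vector \<Rightarrow> real" and B :: "'a set"
  assumes "finite B" "span B = UNIV" and f: "linear f"
  shows "bounded_linear f"
proof (cases "\<forall>x. f x = 0")
  case True
  then show ?thesis by (simp add: fun_eq_iff[symmetric] bounded_linear_zero eta_contract_eq)
next
  case False
  then obtain y where y: "f y \<noteq> 0" by blast
  interpret f: linear f by (rule f)
  define z where "z = inverse (f y) *\<^sub>R y"
  have fz: "f z = 1" using y by (simp add: z_def f.scale)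
  \<comment> \<open>The projection onto the kernel along \<open>z\<close>; it carries the spanning
    set \<open>B\<close> to a spanning set of the kernel.\<close>
  let ?g = "\<lambda>x. x - f x *\<^sub>R z"
  have g: "linear ?g" by (intro linear_compose_sub linear_ident linearI) (simp_all add: f.add f.scale scaleR_left_distrib)
  have "range ?g = span (?g ` B)" using linear_span_image[OF g, of B] assms(2) by simp
  moreover have "range ?g = {x. f x = 0}"
  proof (intro subset_antisym subsetI)
    fix x assume "x \<in> {x. f x = 0}"
    then have "x = ?g x" by simp
    then show "x \<in> range ?g" by blast
  qed (auto simp: f.diff f.scale fz)
  ultimately have "closed {x. f x = 0}"
    using closed_span_finite[of "?g ` B"] assms(1) by simp
  then have "open (- {x. f x = 0})" by (simp add: closed_def)
  moreover have "z \<in> - {x. f x = 0}" using fz by simp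
  ultimately obtain r where r: "r > 0" "ball z r \<subseteq> - {x. f x = 0}" by (rule openE)
  have bound: "norm (f x) \<le> norm x * inverse r" for x
  proof (cases "f x = 0")
    case False
    \<comment> \<open>A point of the kernel at distance \<open>norm x / \<bar>f x\<bar>\<close> from
      \<open>z\<close>, which cannot lie in the ball of radius \<open>r\<close>.\<close>
    have "f (z - inverse (f x) *\<^sub>R x) = 0" using False fz by (simp add: f.diff f.scale)
    then have "r \<le> dist z (z - inverse (f x) *\<^sub>R x)" using r(2) by (force simp: not_less)
    also have "\<dots> = norm x / \<bar>f x\<bar>" by (simp add: dist_norm divide_inverse)
    finally show ?thesis using False r(1) by (simp add: field_simps)
  qed (use r in simp)
  show ?thesis by (rule bounded_linear_intro[OF f.add f.scale bound])
qed

text \<open>Expand in a basis: the coordinates are bounded functionals, and the map is a finite sum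
  of coordinates times fixed vectors.\<close>

lemma bounded_linear_finite_dim:
  fixes f :: "'a::real_normed_vector \<Rightarrow> 'b::real_normed_vector" and B :: "'a set"
  assumes "finite B" "span B = UNIV" and f: "linear f"
  shows "bounded_linear f"
proof -
  obtain C where C: "C \<subseteq> B" "independent C" "B \<subseteq> span C"
    by (rule real_vector.maximal_independent_subset[of B]) blast
  have span: "span C = UNIV" using C(3) assms(2) by (metis span_mono span_span top.extremum_uniqueI)
  have finC: "finite C" using C(1) assms(1) by (rule finite_subset)
  interpret f: linear f by (rule f)
  have eq: "(\<lambda>x. \<Sum>b\<in>C. representation C x b *\<^sub>R f b) = f"
  proof
    fix x
    have "x = (\<Sum>b\<in>C. representation C x b *\<^sub>R b)"
      using real_vector.sum_representation_eq[OF C(2), of x C] span finC by simp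
    then have "f x = f (\<Sum>b\<in>C. representation C x b *\<^sub>R b)" by simp
    then show "(\<Sum>b\<in>C. representation C x b *\<^sub>R f b) = f x" by (simp add: f.sum f.scale)
  qed
  have "linear (\<lambda>x. representation C x b)" for b
    using C(2) span by (intro linearI) (simp_all add: real_vector.representation_add real_vector.representation_scale)
  then have "bounded_linear (\<lambda>x. representation C x b)" for b
    by (intro bounded_linear_functional_finite_dim[OF finC span])
  then have "bounded_linear (\<lambda>x. \<Sum>b\<in>C. representation C x b *\<^sub>R f b)"
    by (intro bounded_linear_sum bounded_linear_scaleR_const)
  then show ?thesis unfolding eq .
qed

text \<open>Restriction of scalars: a real basis of \<open>'k\<close> times a basis over
  \<open>'k\<close> spans over the reals, which makes the real normed space \<open>'g\<close> finite
  dimensional.\<close>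

lemma lie_algebra_real_basis:
  fixes s :: "'k::{real_normed_field,euclidean_space} \<Rightarrow> 'g::real_normed_vector \<Rightarrow> 'g"
  assumes "lie_algebra s br"
  obtains B :: "'g set" where "finite B" "span B = UNIV"
proof -
  obtain B where "finite_dimensional_vector_space s B"
    using assms unfolding lie_algebra_def by blast
  then interpret K: finite_dimensional_vector_space s B .
  have sr: "s (of_real r) x = r *\<^sub>R x" for r x using assms by (simp add: lie_algebra_def)
  let ?B = "(\<lambda>(e, b). s e b) ` (Basis \<times> B)"
  have "x \<in> span ?B" for x
  proof -
    have "x \<in> K.span B" using K.span_Basis by simp
    then show ?thesis
    proof (induct rule: K.span_induct_alt)
      case (step c b y)
      have "s c b = s (\<Sum>e\<in>Basis. (c \<bullet> e) *\<^sub>R e) b" by (simp add: euclidean_representation)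
      also have "\<dots> = (\<Sum>e\<in>Basis. (c \<bullet> e) *\<^sub>R s e b)"
        by (simp add: K.scale_sum_left scaleR_conv_of_real K.scale_scale[symmetric] sr del: K.scale_scale)
      also have "\<dots> \<in> span ?B"
        using step by (intro span_sum span_scale span_base) auto
      finally show ?case using step by (intro span_add)
    qed (simp add: span_zero)
  qed
  then show ?thesis using K.finite_Basis by (intro that[of ?B]) auto
qed

lemma lie_algebra_linear_bounded:
  fixes s :: "'k::{real_normed_field,euclidean_space} \<Rightarrow> 'g::real_normed_vector \<Rightarrow> 'g"
    and f :: "'g \<Rightarrow> 'b::real_normed_vector"
  assumes "lie_algebra s br" "linear f"
  shows "bounded_linear f"
  using lie_algebra_real_basis[OF assms(1)] bounded_linear_finite_dim[OF _ _ assms(2)] by metis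

text \<open>A nonzero vector has a nonzero coordinate in a basis over \<open>'k\<close>, and that
  coordinate function is the functional.\<close>

lemma lie_algebra_separating_functional:
  fixes s :: "'k::{real_normed_field,euclidean_space} \<Rightarrow> 'g::real_normed_vector \<Rightarrow> 'g"
  assumes lie: "lie_algebra s br" and z: "z \<noteq> 0"
  obtains h :: "'g \<Rightarrow> 'k" where "bounded_linear h" "\<And>a x. h (s a x) = a * h x" "h z \<noteq> 0"
proof -
  obtain B where "finite_dimensional_vector_space s B"
    using lie unfolding lie_algebra_def by blast
  then interpret K: finite_dimensional_vector_space s B .
  have sr: "s (of_real r) x = r *\<^sub>R x" for r x using lie by (simp add: lie_algebra_def)
  have "\<exists>b. K.representation B z b \<noteq> 0"
  proof (rule ccontr)
    assume "\<nexists>b. K.representation B z b \<noteq> 0"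
    then have "(\<Sum>b | K.representation B z b \<noteq> 0. s (K.representation B z b) b) = 0" by simp
    then show False
      using K.sum_nonzero_representation_eq[OF K.independent_Basis, of z] z K.span_Basis by simp
  qed
  then obtain b where b: "K.representation B z b \<noteq> 0" by blast
  let ?h = "\<lambda>x. K.representation B x b"
  have sc: "?h (s a x) = a * ?h x" for a x
    using K.representation_scale[OF K.independent_Basis] K.span_Basis by simp
  have "linear ?h"
  proof (rule linearI)
    show "?h (x + y) = ?h x + ?h y" for x y
      using K.representation_add[OF K.independent_Basis] K.span_Basis by simp
    show "?h (r *\<^sub>R x) = r *\<^sub>R ?h x" for r x
      using sc[of "of_real r" x] by (simp add: sr scaleR_conv_of_real)
  qed
  then show ?thesis using that[of ?h] lie_algebra_linear_bounded[OF lie] sc b by blast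
qed

text \<open>If all brackets vanished, the first derived algebra would be zero and the whole algebra
  would be a nonzero solvable ideal.\<close>

lemma semisimple_nonabelian:
  fixes br :: "'g \<Rightarrow> 'g \<Rightarrow> 'g::real_normed_vector"
  assumes lie: "lie_algebra s br" and semi: "semisimple s br" and "(UNIV :: 'g set) \<noteq> {0}"
  obtains x y where "br x y \<noteq> 0"
proof -
  obtain B where "finite_dimensional_vector_space s B"
    using lie unfolding lie_algebra_def by blast
  then interpret K: finite_dimensional_vector_space s B .
  have "\<exists>x y. br x y \<noteq> 0"
  proof (rule ccontr)
    assume "\<nexists>x y. br x y \<noteq> 0"
    then have "{br x y | x y. x \<in> UNIV \<and> y \<in> UNIV} = {0}" by auto
    then have "derived_series s br UNIV 1 = {0}" by simp
    moreover have "lie_ideal s br UNIV" by (simp add: lie_ideal_def)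
    ultimately show False using semi assms(3) unfolding semisimple_def by blast
  qed
  then show ?thesis using that by blast
qed


section \<open>Smooth maps\<close>

lemma has_derivative_cong_open:
  assumes "open S" "x \<in> S" "\<And>y. y \<in> S \<Longrightarrow> f y = g y"
  shows "(f has_derivative D) (at x) \<longleftrightarrow> (g has_derivative D) (at x)"
  using assms has_derivative_transform_within_open[of f D x UNIV S g]
    has_derivative_transform_within_open[of g D x UNIV S f] by auto

lemma frechet_derivative_cong_open:
  assumes "open S" "x \<in> S" "\<And>y. y \<in> S \<Longrightarrow> f y = g y"
  shows "frechet_derivative f (at x) = frechet_derivative g (at x)"
  unfolding frechet_derivative_def using has_derivative_cong_open[OF assms] by simp

text \<open>Formulas for derivatives hold only on \<open>S\<close>, and forms are cut off outside
  chart images; openness lets maps that agree on \<open>S\<close> be exchanged at every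
  order.\<close>

lemma C_times_cong:
  assumes "open S" "\<And>y. y \<in> S \<Longrightarrow> f y = g y" "C_times k S f"
  shows "C_times k S g"
  using assms(2,3)
proof (induct k arbitrary: f g)
  case 0
  then show ?case using continuous_on_cong[of S S f g] by simp
next
  case (Suc k)
  have "g differentiable (at x)" if "x \<in> S" for x
    using Suc(2,3) that has_derivative_cong_open[OF assms(1) that, of f g]
    unfolding C_times.simps differentiable_def by blast
  moreover have "C_times k S (\<lambda>x. frechet_derivative g (at x) v)" for v
  proof (rule Suc(1))
    show "C_times k S (\<lambda>x. frechet_derivative f (at x) v)" using Suc by simp
    show "frechet_derivative f (at y) v = frechet_derivative g (at y) v" if "y \<in> S" for y
      using frechet_derivative_cong_open[OF assms(1) that, of f g] Suc(2) by simp
  qed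
  ultimately show ?case by simp
qed

lemma C_times_const: "C_times k S (\<lambda>x. a)"
  by (induct k arbitrary: a) (simp_all add: frechet_derivative_const)

lemma C_times_add:
  assumes "open S" "C_times k S f" "C_times k S g"
  shows "C_times k S (\<lambda>x. f x + g x)"
  using assms(2,3)
proof (induct k arbitrary: f g)
  case (Suc k)
  have "C_times k S (\<lambda>x. frechet_derivative (\<lambda>x. f x + g x) (at x) v)" for v
  proof (rule C_times_cong[OF assms(1)])
    show "C_times k S (\<lambda>x. frechet_derivative f (at x) v + frechet_derivative g (at x) v)"
      using Suc by (intro Suc(1)) auto
    show "frechet_derivative f (at y) v + frechet_derivative g (at y) v =
        frechet_derivative (\<lambda>x. f x + g x) (at y) v" if "y \<in> S" for y
    proof -
      have "((\<lambda>x. f x + g x) has_derivative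
          (\<lambda>v. frechet_derivative f (at y) v + frechet_derivative g (at y) v)) (at y)"
        using Suc that by (intro has_derivative_add) (auto simp: frechet_derivative_works[symmetric])
      from frechet_derivative_at[OF this] show ?thesis by metis
    qed
  qed
  then show ?case using Suc by auto
qed (simp add: continuous_on_add)

lemma C_times_bounded_linear:
  assumes "open S" "bounded_linear L" "C_times k S f"
  shows "C_times k S (\<lambda>x. L (f x))"
  using assms(3)
proof (induct k arbitrary: f)
  case 0
  then show ?case using bounded_linear.continuous_on[OF assms(2)] by simp
next
  case (Suc k)
  have der: "((\<lambda>x. L (f x)) has_derivative (\<lambda>v. L (frechet_derivative f (at y) v))) (at y)" if "y \<in> S" for y
    using Suc that by (intro bounded_linear.has_derivative[OF assms(2)])
      (auto simp: frechet_derivative_works[symmetric])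
  have "C_times k S (\<lambda>x. frechet_derivative (\<lambda>x. L (f x)) (at x) v)" for v
  proof (rule C_times_cong[OF assms(1)])
    show "C_times k S (\<lambda>x. L (frechet_derivative f (at x) v))"
      using Suc by (intro Suc(1)) auto
    show "L (frechet_derivative f (at y) v) = frechet_derivative (\<lambda>x. L (f x)) (at y) v" if "y \<in> S" for y
      using frechet_derivative_at[OF der[OF that]] by metis
  qed
  moreover have "(\<lambda>x. L (f x)) differentiable (at y)" if "y \<in> S" for y
    using der[OF that] unfolding differentiable_def by blast
  ultimately show ?case by simp
qed

lemma smooth_on_iter_deriv: "smooth_on S f \<Longrightarrow> smooth_on S (iter_deriv ws f)"
proof (induct ws)
  case (Cons w ws)
  then have "C_times (Suc k) S (iter_deriv ws f)" for k by (simp add: smooth_on_def del: C_times.simps)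
  then show ?case by (simp add: smooth_on_def)
qed simp

lemma smooth_on_continuous: "smooth_on S f \<Longrightarrow> continuous_on S f"
  by (metis smooth_on_def C_times.simps(1))


section \<open>Differential forms\<close>

lemma chart_open:
  assumes "oriented_atlas (atlas M)" "c \<in> atlas M"
  shows "open (cimg c)"
  using assms by (simp add: oriented_atlas_def is_chart_def)

lemma OmegaD:
  assumes "\<omega> \<in> Omega M p"
  shows "c \<notin> atlas M \<or> x \<notin> cimg c \<or> length vs \<noteq> p \<Longrightarrow> \<omega> c x vs = 0"
    and "c \<in> atlas M \<Longrightarrow> x \<in> cimg c \<Longrightarrow> length us + 1 + length ws = p \<Longrightarrow> linear (\<lambda>v. \<omega> c x (us @ [v] @ ws))"
    and "c \<in> atlas M \<Longrightarrow> x \<in> cimg c \<Longrightarrow> \<omega> c x (us @ [v] @ vs @ [v] @ ws) = 0"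
    and "c \<in> atlas M \<Longrightarrow> smooth_on (cimg c) (\<lambda>x. \<omega> c x vs)"
    and "c \<in> atlas M \<Longrightarrow> c' \<in> atlas M \<Longrightarrow> x \<in> overlap c c' \<Longrightarrow>
        \<omega> c x vs = \<omega> c' (trans_map c c' x) (map (dtrans c c' x) vs)"
  using assms unfolding Omega_def mem_Collect_eq by blast+

lemma OmegaI:
  assumes "\<And>c x vs. c \<notin> atlas M \<or> x \<notin> cimg c \<or> length vs \<noteq> p \<Longrightarrow> \<omega> c x vs = 0"
    and "\<And>c x us ws. c \<in> atlas M \<Longrightarrow> x \<in> cimg c \<Longrightarrow> length us + 1 + length ws = p \<Longrightarrow> linear (\<lambda>v. \<omega> c x (us @ [v] @ ws))"
    and "\<And>c x us v vs ws. c \<in> atlas M \<Longrightarrow> x \<in> cimg c \<Longrightarrow> \<omega> c x (us @ [v] @ vs @ [v] @ ws) = 0"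
    and "\<And>c vs. c \<in> atlas M \<Longrightarrow> smooth_on (cimg c) (\<lambda>x. \<omega> c x vs)"
    and "\<And>c c' x vs. c \<in> atlas M \<Longrightarrow> c' \<in> atlas M \<Longrightarrow> x \<in> overlap c c' \<Longrightarrow>
        \<omega> c x vs = \<omega> c' (trans_map c c' x) (map (dtrans c c' x) vs)"
  shows "\<omega> \<in> Omega M p"
  unfolding Omega_def mem_Collect_eq using assms by (intro conjI allI ballI impI)

lemma Omega_add:
  assumes at: "oriented_atlas (atlas M)" and \<alpha>: "\<alpha> \<in> Omega M p" and \<beta>: "\<beta> \<in> Omega M p"
  shows "\<alpha> + \<beta> \<in> Omega M p"
proof (rule OmegaI)
  fix c vs assume "c \<in> atlas M"
  then show "smooth_on (cimg c) (\<lambda>x. (\<alpha> + \<beta>) c x vs)"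
    using OmegaD(4)[OF \<alpha>] OmegaD(4)[OF \<beta>] chart_open[OF at] by (simp add: smooth_on_def C_times_add)
next
  fix c x and us ws :: "(real ^ 'b) list" assume "c \<in> atlas M" "x \<in> cimg c" "length us + 1 + length ws = p"
  from OmegaD(2)[OF \<alpha> this] OmegaD(2)[OF \<beta> this] show "linear (\<lambda>v. (\<alpha> + \<beta>) c x (us @ [v] @ ws))"
    using linear_compose_add by simp
next
  fix c c' x vs assume "c \<in> atlas M" "c' \<in> atlas M" "x \<in> overlap c c'"
  from OmegaD(5)[OF \<alpha> this] OmegaD(5)[OF \<beta> this]
  show "(\<alpha> + \<beta>) c x vs = (\<alpha> + \<beta>) c' (trans_map c c' x) (map (dtrans c c' x) vs)"
    by (metis plus_fun_apply)
qed (simp_all only: plus_fun_apply OmegaD(1,3)[OF \<alpha>] OmegaD(1,3)[OF \<beta>] add_0)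

lemma Omega_bounded_linear:
  assumes at: "oriented_atlas (atlas M)" and L: "bounded_linear L" and \<omega>: "\<omega> \<in> Omega M p"
  shows "(\<lambda>c x vs. L (\<omega> c x vs)) \<in> Omega M p"
proof (rule OmegaI)
  fix c vs assume "c \<in> atlas M"
  then show "smooth_on (cimg c) (\<lambda>x. L (\<omega> c x vs))"
    using OmegaD(4)[OF \<omega>] chart_open[OF at] C_times_bounded_linear[OF _ L] unfolding smooth_on_def by blast
next
  fix c x and us ws :: "(real ^ 'b) list" assume "c \<in> atlas M" "x \<in> cimg c" "length us + 1 + length ws = p"
  from OmegaD(2)[OF \<omega> this] show "linear (\<lambda>v. L (\<omega> c x (us @ [v] @ ws)))"
    using linear_compose[of "\<lambda>v. \<omega> c x (us @ [v] @ ws)" L] bounded_linear.linear[OF L] by (simp add: o_def)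
next
  fix c c' x vs assume "c \<in> atlas M" "c' \<in> atlas M" "x \<in> overlap c c'"
  from OmegaD(5)[OF \<omega> this] show "L (\<omega> c x vs) = L (\<omega> c' (trans_map c c' x) (map (dtrans c c' x) vs))"
    by metis
qed (simp_all only: OmegaD(1,3)[OF \<omega>] linear_0[OF bounded_linear.linear[OF L]])

section \<open>Constant functions as closed forms\<close>

definition const_form :: "('a, 'm::finite) spacetime \<Rightarrow> 'g \<Rightarrow> ('a, 'm, 'g::real_normed_vector) form" where
  "const_form M t c x vs = (if c \<in> atlas M \<and> x \<in> cimg c \<and> vs = [] then t else 0)"

lemma zero_in_Omega: "0 \<in> Omega M p"
  by (rule OmegaI) (auto simp: smooth_on_def C_times_const linear_zero)

lemma const_form_in_Omega:
  assumes at: "oriented_atlas (atlas M)"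
  shows "const_form M t \<in> Omega M 0"
proof (rule OmegaI)
  fix c and vs :: "(real ^ 'b) list" assume c: "c \<in> atlas M"
  show "smooth_on (cimg c) (\<lambda>x. const_form M t c x vs)"
    unfolding smooth_on_def
    by (intro allI C_times_cong[OF chart_open[OF at c] _ C_times_const[of _ _ "if vs = [] then t else 0"]])
      (simp add: const_form_def c)
next
  fix c c' x vs assume c: "c \<in> atlas M" "c' \<in> atlas M" "x \<in> overlap c c'"
  then obtain p where p: "p \<in> cdom c" "p \<in> cdom c'" "x = coord c p" by (auto simp: overlap_def)
  have "is_chart c" using at c by (simp add: oriented_atlas_def)
  then have "param c x = p" using p by (simp add: is_chart_def homeomorphism_def)
  then have "x \<in> cimg c" "trans_map c c' x \<in> cimg c'" using p by (auto simp: cimg_def trans_map_def)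
  then show "const_form M t c x vs = const_form M t c' (trans_map c c' x) (map (dtrans c c' x) vs)"
    using c by (simp add: const_form_def)
qed (auto simp: const_form_def)

lemma ext_d_zero: "ext_d M 0 = 0"
  by (auto simp: ext_d_def fun_eq_iff frechet_derivative_const)

lemma hodge_zero: "hodge M p 0 = 0"
  by (auto simp: hodge_def fun_eq_iff)

lemma ext_d_const_form:
  assumes at: "oriented_atlas (atlas M)"
  shows "ext_d M (const_form M t) = 0"
proof (intro ext)
  fix c x vs
  have "frechet_derivative (\<lambda>y. const_form M t c y us) (at x) v = 0" if c: "c \<in> atlas M" "x \<in> cimg c" for us v
  proof -
    have "frechet_derivative (\<lambda>y. const_form M t c y us) (at x) =
        frechet_derivative (\<lambda>y. if us = [] then t else 0) (at x)"
      using c by (intro frechet_derivative_cong_open[OF chart_open[OF at c(1)]]) (auto simp: const_form_def)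
    then show ?thesis by (simp add: frechet_derivative_const)
  qed
  then show "ext_d M (const_form M t) c x vs = 0 c x vs" by (simp add: ext_d_def)
qed


section \<open>The Yang-Mills complex\<close>

lemma ym_complex_simps:
  "scl (ym_complex s M) = (\<lambda>a v i c x vs. s a (v i c x vs))"
  "total (ym_complex s M) = ym_total M"
  "homog (ym_complex s M) = (\<lambda>i. {v \<in> ym_total M. \<forall>j. j \<noteq> i \<longrightarrow> v j = 0})"
  "seminorms (ym_complex s M) = {\<lambda>v. (SUP x\<in>X. norm (iter_deriv ws (\<lambda>y. v i c y vs) x)) | i c X ws vs.
        c \<in> atlas M \<and> compact X \<and> X \<noteq> {} \<and> X \<subseteq> cimg c}"
  by (simp_all add: ym_complex_def)

lemma strong_dual_simps:
  "scl (strong_dual V) = (\<lambda>a \<phi> x. a * \<phi> x)"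
  "total (strong_dual V) = functionals V"
  "homog (strong_dual V) = (\<lambda>i. {\<phi> \<in> functionals V. \<forall>j. j \<noteq> - i \<longrightarrow> (\<forall>x\<in>homog V j. \<phi> x = 0)})"
  "seminorms (strong_dual V) = {\<lambda>\<phi>. (SUP x\<in>B. norm (\<phi> x)) | B. bounded_subset V B \<and> B \<noteq> {}}"
  by (simp_all add: strong_dual_def)

lemma ym_total_component:
  assumes "v \<in> ym_total M"
  shows "\<exists>p. v i \<in> Omega M p"
proof (cases "i \<in> {- 1, 0, 1, 2}")
  case True
  then show ?thesis using assms unfolding ym_total_def by auto
next
  case False
  then have "v i = 0" using assms unfolding ym_total_def by simp
  then show ?thesis using zero_in_Omega by metis
qed

text \<open>A real supremum is controlled only for sets bounded above; compactness of
  \<open>X\<close> and smoothness supply the bound.\<close>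

lemma ym_seminorm_nonneg:
  assumes "p \<in> seminorms (ym_complex s M)" "v \<in> ym_total M"
  shows "0 \<le> p v"
proof -
  obtain i c X ws vs where p: "p = (\<lambda>v. (SUP x\<in>X. norm (iter_deriv ws (\<lambda>y. v i c y vs) x)))"
    and X: "c \<in> atlas M" "compact X" "X \<noteq> {}" "X \<subseteq> cimg c"
    using assms(1) unfolding ym_complex_simps by blast
  obtain q where "v i \<in> Omega M q" using ym_total_component[OF assms(2)] by blast
  then have "smooth_on (cimg c) (\<lambda>y. v i c y vs)" using X by (simp add: OmegaD(4))
  then have "continuous_on X (iter_deriv ws (\<lambda>y. v i c y vs))"
    using X by (meson smooth_on_iter_deriv smooth_on_continuous continuous_on_subset)
  then have "compact ((\<lambda>x. norm (iter_deriv ws (\<lambda>y. v i c y vs) x)) ` X)"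
    using X by (intro compact_continuous_image continuous_on_norm)
  then have bdd: "bdd_above ((\<lambda>x. norm (iter_deriv ws (\<lambda>y. v i c y vs) x)) ` X)"
    by (intro bounded_imp_bdd_above compact_imp_bounded)
  obtain x where "x \<in> X" using X by blast
  from cSUP_upper[OF this bdd] show ?thesis
    unfolding p using norm_ge_zero order_trans by blast
qed

text \<open>Again the supremum needs an upper bound: a continuous functional is bounded on bounded
  subsets.\<close>

lemma strong_dual_nonneg_glcs:
  assumes nonneg: "\<And>p v. p \<in> seminorms V \<Longrightarrow> v \<in> total V \<Longrightarrow> 0 \<le> p v"
  shows "nonneg_glcs (strong_dual V)"
proof
  fix q \<phi> assume q: "q \<in> seminorms (strong_dual V)" and \<phi>: "\<phi> \<in> total (strong_dual V)"
  obtain B where B: "q = (\<lambda>\<phi>. (SUP x\<in>B. norm (\<phi> x)))" "bounded_subset V B" "B \<noteq> {}"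
    using q unfolding strong_dual_simps by blast
  have "seminorm_continuous (total V) (seminorms V) {norm} \<phi>"
    using \<phi> by (simp add: strong_dual_simps functionals_def)
  then obtain F C where F: "finite F" "F \<subseteq> seminorms V"
    and C: "\<And>x. x \<in> total V \<Longrightarrow> norm (\<phi> x) \<le> C * (\<Sum>p\<in>F. p x)"
    unfolding seminorm_continuous_def by auto
  have "\<forall>p\<in>F. \<exists>K. \<forall>x\<in>B. p x \<le> K"
    using B(2) F(2) unfolding bounded_subset_def bdd_above_def by (meson image_eqI subsetD)
  then obtain K where K: "\<And>p x. p \<in> F \<Longrightarrow> x \<in> B \<Longrightarrow> p x \<le> K p" by metis
  \<comment> \<open>The absolute value is there because continuity does not fix the sign of
    \<open>C\<close>.\<close>
  have "norm (\<phi> x) \<le> \<bar>C\<bar> * (\<Sum>p\<in>F. K p)" if x: "x \<in> B" for x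
  proof -
    have xt: "x \<in> total V" using x B(2) by (auto simp: bounded_subset_def)
    have nn: "0 \<le> (\<Sum>p\<in>F. p x)" using F xt by (intro sum_nonneg nonneg) auto
    have "norm (\<phi> x) \<le> C * (\<Sum>p\<in>F. p x)" by (rule C[OF xt])
    also have "\<dots> \<le> \<bar>C\<bar> * (\<Sum>p\<in>F. p x)" using nn by (intro mult_right_mono) auto
    also have "\<dots> \<le> \<bar>C\<bar> * (\<Sum>p\<in>F. K p)" using K x by (intro mult_left_mono sum_mono) auto
    finally show ?thesis .
  qed
  then have bdd: "bdd_above ((\<lambda>x. norm (\<phi> x)) ` B)" by (auto simp: bdd_above_def)
  obtain x where "x \<in> B" using B by blast
  from cSUP_upper[OF this bdd] show "0 \<le> q \<phi>"
    unfolding B(1) using norm_ge_zero order_trans by blast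
qed (simp add: strong_dual_simps)

text \<open>Functionals are extended by zero off the total space, so additivity of an evaluation
  depends on this closure property.\<close>

lemma ym_total_add:
  assumes "oriented_atlas (atlas M)" "v \<in> ym_total M" "w \<in> ym_total M"
  shows "v + w \<in> ym_total M"
  using assms unfolding ym_total_def by (simp add: Omega_add)

text \<open>Taking \<open>s a\<close> for \<open>L\<close>, this gives closure under scalars from
  \<open>'k\<close>.\<close>

lemma ym_total_bounded_linear:
  assumes "oriented_atlas (atlas M)" "bounded_linear L" "v \<in> ym_total M"
  shows "(\<lambda>i c x vs. L (v i c x vs)) \<in> ym_total M"
  using assms linear_0[OF bounded_linear.linear[OF assms(2)]] unfolding ym_total_def
  by (simp add: Omega_bounded_linear zero_fun_def)

text \<open>The parameter of a global infinitesimal gauge transformation, which leaves the trivial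
  background fixed.\<close>

definition ghost :: "('a, 'm::finite) spacetime \<Rightarrow> 'g \<Rightarrow> ('a, 'm, 'g::real_normed_vector) field" where
  "ghost M t = (\<lambda>i. if i = - 1 then const_form M t else 0)"

lemma ghost_in_ym_total: "oriented_atlas (atlas M) \<Longrightarrow> ghost M t \<in> ym_total M"
  by (auto simp: ghost_def ym_total_def const_form_in_Omega zero_in_Omega)

lemma ghost_homog: "oriented_atlas (atlas M) \<Longrightarrow> ghost M t \<in> homog (ym_complex s M) (- 1)"
  by (simp add: ym_complex_simps ghost_in_ym_total) (simp add: ghost_def)

lemma ym_ell1_ghost:
  assumes "oriented_atlas (atlas M)"
  shows "ym_ell1 M (ghost M t) = 0"
  by (rule ext) (simp add: ym_ell1_def ghost_def ext_d_const_form[OF assms] ext_d_zero hodge_zero)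

lemma ym_ell2_ghost:
  fixes M :: "('a, 'm::{finite,linorder}) spacetime" and br :: "'g \<Rightarrow> 'g \<Rightarrow> 'g::real_normed_vector"
  assumes lie: "lie_algebra s br"
  shows "ym_ell2 M br (ghost M t) (ghost M u) = ghost M (- br t u)"
proof
  fix i
  have br: "br (x + y) z = br x z + br y z" "br z (x + y) = br z x + br z y" for x y z
    using lie unfolding lie_algebra_def by blast+
  have br0: "br 0 x = 0" "br x 0 = 0" for x using br(1)[of 0 0 x] br(2)[of x 0 0] by simp_all
  have z: "form_bracket br p q 0 \<beta> = 0" "form_bracket br p q \<beta> 0 = 0" for p q and \<beta> :: "('a, 'm, 'g) form"
    by (auto simp: form_bracket_def fun_eq_iff br0)
  have "form_bracket br 0 0 (const_form M t) (const_form M u) = const_form M (br t u)"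
  proof (intro ext)
    fix c x vs
    \<comment> \<open>Only the empty shuffle occurs, so the bracket of functions is the pointwise
      Lie bracket.\<close>
    have "{I::nat set. I \<subseteq> {..<0 + 0} \<and> card I = 0} = {{}}" by auto
    then show "form_bracket br 0 0 (const_form M t) (const_form M u) c x vs = const_form M (br t u) c x vs"
      by (simp add: form_bracket_def shuffle_sign_def const_form_def br0)
  qed
  moreover have "- const_form M (br t u) = const_form M (- br t u)"
    by (auto simp: const_form_def fun_eq_iff)
  ultimately show "ym_ell2 M br (ghost M t) (ghost M u) i = ghost M (- br t u) i"
    by (simp add: ym_ell2_def ghost_def z ext_d_zero hodge_zero Let_def)
qed

text \<open>The ghost component has form degree 0, hence the empty list of tangent vectors. Off the
  total space the value is 0, as \<open>functionals\<close> demands.\<close>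

definition ghost_eval :: "('a, 'm::finite) spacetime \<Rightarrow> ('g \<Rightarrow> 'k) \<Rightarrow> ('a, 'm) chart \<Rightarrow> real ^ 'm \<Rightarrow>
    ('a, 'm, 'g::real_normed_vector) field \<Rightarrow> 'k::real_normed_field" where
  "ghost_eval M h c x v = (if v \<in> ym_total M then h (v (- 1) c x []) else 0)"

lemma ghost_eval_homog:
  fixes s :: "'k::{real_normed_field,euclidean_space} \<Rightarrow> 'g::real_normed_vector \<Rightarrow> 'g"
  assumes at: "oriented_atlas (atlas M)" and lie: "lie_algebra s br"
    and h: "bounded_linear h" "\<And>a x. h (s a x) = a * h x" and c: "c \<in> atlas M" "x \<in> cimg c"
  shows "ghost_eval M h c x \<in> homog (strong_dual (ym_complex s M)) 1"
proof -
  interpret h: bounded_linear h by (rule h(1))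
  obtain B where "finite_dimensional_vector_space s B"
    using lie unfolding lie_algebra_def by blast
  then interpret K: finite_dimensional_vector_space s B .
  have lin: "linear (s a)" for a
  proof (rule linearI)
    have sr: "s (of_real r) x = r *\<^sub>R x" for r x using lie by (simp add: lie_algebra_def)
    show "s a (r *\<^sub>R x) = r *\<^sub>R s a x" for r x
      by (simp add: sr[symmetric] mult.commute)
  qed (simp add: K.scale_right_distrib)
  have s: "(\<lambda>i c x vs. s a (v i c x vs)) \<in> ym_total M" if "v \<in> ym_total M" for a v
    by (rule ym_total_bounded_linear[OF at lie_algebra_linear_bounded[OF lie lin] that])
  obtain C where C: "\<And>y. norm (h y) \<le> norm y * C" using h.bounded by blast
  \<comment> \<open>With one point, no derivatives and no tangent vectors, this seminorm is the norm
    of the ghost at the chosen point.\<close>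
  let ?p = "\<lambda>v. (SUP y\<in>{x}. norm (iter_deriv [] (\<lambda>y. v (- 1 :: int) c y []) y))"
  have "?p \<in> seminorms (ym_complex s M)"
    unfolding ym_complex_simps mem_Collect_eq
    by (intro exI[of _ "- 1"] exI[of _ c] exI[of _ "{x}"] exI[of _ "[]"]) (use c in simp)
  moreover have "norm (ghost_eval M h c x v) \<le> C * (\<Sum>p\<in>{?p}. p v)" if "v \<in> ym_total M" for v
    using C[of "v (- 1) c x []"] that by (simp add: ghost_eval_def mult.commute)
  ultimately have "seminorm_continuous (ym_total M) (seminorms (ym_complex s M)) {norm} (ghost_eval M h c x)"
    unfolding seminorm_continuous_def by (intro ballI exI[of _ "{?p}"] exI[of _ C]) auto
  then have "ghost_eval M h c x \<in> functionals (ym_complex s M)"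
    by (simp add: functionals_def ym_complex_simps)
      (simp add: ghost_eval_def h.add h(2) ym_total_add[OF at] s)
  moreover have "ghost_eval M h c x v = 0" if "v \<in> homog (ym_complex s M) j" "j \<noteq> - 1" for v j
    using that by (simp add: ym_complex_simps ghost_eval_def h.zero)
  ultimately show ?thesis by (simp add: strong_dual_simps)
qed


section \<open>Pairing with two ghosts\<close>

text \<open>\<open>eval_form\<close> sums over permutations, and every term has a factor in which
  \<open>w\<close> is applied to \<open>x\<close> or to \<open>y\<close>.\<close>

lemma eval_form_pair_eq_0:
  assumes "w x = 0" "w y = 0"
  shows "eval_form V [i, j] [x, y] [w, u] = 0" "eval_form V [i, j] [x, y] [u, w] = 0"
proof -
  have "w ([x, y] ! \<sigma> k) = 0" if "\<sigma> permutes {..<2}" "k < 2" for \<sigma> k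
  proof -
    have "\<sigma> k < 2" using permutes_in_image[OF that(1), of k] that(2) by simp
    then show ?thesis using assms by (cases "\<sigma> k = 0") (auto simp: less_2_cases_iff)
  qed
  then have "(\<Prod>k<2. ([w, u] ! k) ([x, y] ! \<sigma> k)) = 0" "(\<Prod>k<2. ([u, w] ! k) ([x, y] ! \<sigma> k)) = 0"
    if "\<sigma> permutes {..<2}" for \<sigma>
    using that by (simp_all add: numeral_2_eq_2 lessThan_Suc)
  then show "eval_form V [i, j] [x, y] [w, u] = 0" "eval_form V [i, j] [x, y] [u, w] = 0"
    unfolding eval_form_def Let_def by (auto intro!: sum.neutral simp: numeral_2_eq_2[symmetric])
qed

lemma zero_functional: "0 \<in> functionals V"
  unfolding functionals_def seminorm_continuous_def
  by (auto intro!: exI[of _ "{}"])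

lemma functional_zero:
  assumes "\<phi> \<in> functionals V" "0 \<in> total V"
  shows "\<phi> 0 = 0"
proof -
  have "\<phi> (0 + 0) = \<phi> 0 + \<phi> 0" using assms unfolding functionals_def by blast
  then show ?thesis by simp
qed

lemma sym_gen_zero:
  assumes "0 \<in> total V"
  shows "sym_gen V 0 = 0"
proof -
  have "\<beta> [0] = 0" if "\<beta> \<in> cont_forms V 1" for \<beta>
  proof -
    obtain P C where "\<beta> \<in> form_ball V 1 P C" using \<open>\<beta> \<in> cont_forms V 1\<close> unfolding cont_forms_def by auto
    then have "\<forall>us ws. length us + 1 + length ws = 1 \<and> set us \<subseteq> total V \<and> set ws \<subseteq> total V \<longrightarrow>
        (\<forall>v\<in>total V. \<forall>w\<in>total V. \<beta> (us @ [v + w] @ ws) = \<beta> (us @ [v] @ ws) + \<beta> (us @ [w] @ ws))"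
      unfolding form_ball_def by blast
    from this[rule_format, of "[]" "[]" 0 0] have "\<beta> [0 + 0] = \<beta> [0] + \<beta> [0]" using assms by simp
    then show ?thesis by simp
  qed
  then show ?thesis by (auto simp: sym_gen_def sym_class_def pure_tensor_def fun_eq_iff)
qed

theorem mainTheorem8:
  fixes M :: "('a::{t2_space,second_countable_topology}, 'm::{finite,linorder}) spacetime"
    and s :: "'k::{real_normed_field,euclidean_space} \<Rightarrow> 'g::real_normed_vector \<Rightarrow> 'g"
    and br :: "'g \<Rightarrow> 'g \<Rightarrow> 'g"
  assumes "CARD('m) \<ge> 2"
    and "globally_hyperbolic M"
    and "\<exists>\<Sigma>. compact \<Sigma> \<and> cauchy_surface M \<Sigma> \<and> spacelike_hypersurface M \<Sigma>"
    and "lie_algebra s br"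
    and "semisimple s br"
    and "(UNIV :: 'g set) \<noteq> {0}"
    and "chevalley_eilenberg (ym_complex s M) (ym_brackets M br) \<delta>0 \<delta>"
  shows "\<not> (\<exists>K. moller_map (strong_dual (ym_complex s M)) \<delta>0 \<delta> K)"
proof
  let ?V = "ym_complex s M"
  let ?W = "strong_dual ?V"
  let ?ell = "ym_brackets M br"
  assume "\<exists>K. moller_map ?W \<delta>0 \<delta> K"
  then obtain K where K: "moller_map ?W \<delta>0 \<delta> K" ..
  note lie = assms(4)
  have at: "oriented_atlas (atlas M)"
    using assms(2) by (simp add: globally_hyperbolic_def oriented_lorentzian_manifold_def)
  interpret nonneg_glcs ?W
    by (rule strong_dual_nonneg_glcs) (simp add: ym_seminorm_nonneg ym_complex_simps(2))
  have \<delta>0: "cont_derivation ?W \<delta>0" and \<delta>: "cont_derivation ?W \<delta>"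
    and \<delta>0_gen: "\<And>k \<phi>. \<phi> \<in> homog ?W k \<Longrightarrow> \<delta>0 (ps_const (sym_gen ?W \<phi>)) = ps_const (sym_gen ?W (dual_diff ?V ?ell k \<phi>))"
    and \<delta>_gen_0: "\<And>k \<phi>. \<phi> \<in> homog ?W k \<Longrightarrow> \<delta> (ps_const (sym_gen ?W \<phi>)) 0 = 0"
    and \<delta>_gen: "\<And>k \<phi> n. \<phi> \<in> homog ?W k \<Longrightarrow> n \<ge> 2 \<Longrightarrow>
      is_transpose ?V ?ell n k \<phi> (\<delta> (ps_const (sym_gen ?W \<phi>)) (n - 1))"
    using assms(7) unfolding chevalley_eilenberg_def by blast+
  obtain t1 t2 where t: "br t1 t2 \<noteq> 0"
    using semisimple_nonabelian[OF lie assms(5,6)] by blast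
  obtain h :: "'g \<Rightarrow> 'k" where h: "bounded_linear h" "\<And>a x. h (s a x) = a * h x" "h (br t1 t2) \<noteq> 0"
    using lie_algebra_separating_functional[OF lie t] by blast
  interpret h: bounded_linear h by (rule h(1))
  \<comment> \<open>The manifold is a type, hence nonempty; \<open>undefined\<close> names some
    point of it, and the charts cover that point.\<close>
  have "undefined \<in> (\<Union>c\<in>atlas M. cdom c)" using at by (simp add: oriented_atlas_def)
  then obtain c p where "c \<in> atlas M" "p \<in> cdom c" by blast
  then obtain x where c: "c \<in> atlas M" "x \<in> cimg c" by (auto simp: cimg_def)
  let ?\<phi> = "ghost_eval M h c x"
  let ?c = "ghost M t1" and ?c' = "ghost M t2"
  let ?\<epsilon> = "eval_form ?V [- 1, - 1] [?c, ?c']"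
  have \<phi>: "?\<phi> \<in> homog ?W 1" by (rule ghost_eval_homog[OF at lie h(1,2) c])
  let ?T = "\<delta> (ps_const (sym_gen ?W ?\<phi>)) 1"
  have T: "is_transpose ?V ?ell 2 1 ?\<phi> ?T" using \<delta>_gen[OF \<phi>, of 2] by simp
  \<comment> \<open>In degree 1 the sign of the transpose is positive, so the value comes out as
    \<open>- h (br t1 t2)\<close>.\<close>
  have "?T 2 ?\<epsilon> = - (if even (1::int) then 1 else - 1) * ?\<phi> (?ell 2 [?c, ?c'])"
    using T[unfolded is_transpose_def, THEN conjunct2, THEN conjunct2, rule_format, of "[?c, ?c']" "[- 1, - 1]"]
    by (simp add: ghost_homog[OF at])
  also have "?ell 2 [?c, ?c'] = ghost M (- br t1 t2)"
    by (simp add: ym_brackets_def ym_ell2_ghost[OF lie])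
  also have "?\<phi> (ghost M (- br t1 t2)) = - h (br t1 t2)"
    using c by (simp add: ghost_eval_def ghost_in_ym_total[OF at]) (simp add: ghost_def const_form_def h.neg)
  finally have nonzero: "?T 2 ?\<epsilon> \<noteq> 0" using h(3) by simp
  have "?T 2 \<in> sym_power ?W 2 (1 + 1)" using T unfolding is_transpose_def Sym_def by blast
  \<comment> \<open>Elements of \<open>sym_power\<close> vanish off \<open>sym_forms\<close>, so there is no need to verify that \<open>?\<epsilon>\<close> is continuous and symmetric.\<close>
  then have \<epsilon>: "?\<epsilon> \<in> sym_forms ?W 2" using sym_power_outside nonzero by blast
  have zero_total: "0 \<in> total ?V" by (simp add: ym_complex_simps(2)) (simp add: ym_total_def zero_in_Omega)
  have gen_zero: "sym_gen ?W 0 = 0" by (rule sym_gen_zero) (simp add: strong_dual_simps zero_functional)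
  have "dual_diff ?V ?ell 1 ?\<phi> = 0"
    by (rule ext) (simp add: dual_diff_def ghost_eval_def ym_brackets_def ym_ell1_def h.zero)
  then have closed: "\<delta>0 (ps_const (sym_gen ?W ?\<phi>)) = 0" by (simp add: \<delta>0_gen[OF \<phi>] gen_zero)
  have "?T 2 ?\<epsilon> = 0"
  proof (rule moller_first_order[OF \<delta>0 \<delta> K \<phi> closed \<epsilon>])
    fix k \<psi> assume \<psi>: "\<psi> \<in> homog ?W k"
    then have "\<psi> \<in> functionals ?V" by (simp add: strong_dual_simps)
    then have "dual_diff ?V ?ell k \<psi> (ghost M u) = 0" for u
      by (simp add: dual_diff_def ym_brackets_def ym_ell1_ghost[OF at] functional_zero[OF _ zero_total])
    then show "\<exists>w. \<delta>0 (ps_const (sym_gen ?W \<psi>)) 0 = sym_gen ?W w \<and> (\<forall>u. ?\<epsilon> [w, u] = 0 \<and> ?\<epsilon> [u, w] = 0)"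
      by (intro exI[of _ "dual_diff ?V ?ell k \<psi>"])
        (simp add: \<delta>0_gen[OF \<psi>] eval_form_pair_eq_0, simp add: ps_const_def)
    \<comment> \<open>On generators \<open>\<delta>\<close> starts at first order in \<lambda>; its
      order zero part is the generator of the zero functional.\<close>
    show "\<exists>w. \<delta> (ps_const (sym_gen ?W \<psi>)) 0 = sym_gen ?W w \<and> (\<forall>u. ?\<epsilon> [w, u] = 0 \<and> ?\<epsilon> [u, w] = 0)"
      using \<delta>_gen_0[OF \<psi>] gen_zero by (intro exI[of _ 0]) (simp add: eval_form_pair_eq_0)
  qed
  with nonzero show False ..
qed

end
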